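(* Let $\alpha\ge1$ and let $\mathbb I=(\mathcal M_1,\dots,\mathcal M_n,\mathcal F)$ be an instance of matroid-min-CICS such that each $\mathcal M_i$ admits an $\alpha$-local approximation under some commitment $\pi_i$ for $\mathcal M_i$. Then $\mathrm{CG}(\mathbb I)\le\alpha$.
   Context: A costly information MDP is $\mathcal M=(S,\sigma,A,c,\mathcal D,V,T)$: a finite state set $S$, start state $\sigma$, terminal states $T\subseteq S$, for each nonterminal $s$ a finite nonempty action set $A(s)$, each action $a$ with cost $c(a)\ge0$ and transition distribution $\mathcal D(s,a,\cdot)$; $V(s)$ is the conditional distribution of an underlying nonnegative random variable given state $s$, $v(s)=\mathbb E[V(s)]$. At a terminal state the only action is "accept" (cost $0$, yields value $v(t)$, ends the process). The transition graph is acyclic with bounded horizon. Matroid-min-CICS: an instance consists of $n$ independently evolving costly information MDPs and a matroid on $[n]$; $\mathcal F$ is the family of subsets of $[n]$ containing a basis. A policy adaptively chooses at each step an unaccepted MDP and an action in its current state, paying its cost (accepting a terminal state adds that MDP to the accepted set $S$ and incurs its value), and stops as soon as $S\in\mathcal F$. $\mathrm{OPT}(\mathbb I)$ is the minimum expected total cost (action costs plus accepted values). A commitment $\pi$ for $\mathcal M$ assigns to each nonterminal state a probability distribution over its actions; $\mathcal M^\pi$ is the Markov chain in which at each state an action is drawn from $\pi(s)$. For a tuple $\mathcal P=(\pi_1,\dots,\pi_n)$, $\mathbb I_{|\mathcal P}=(\mathcal M_1^{\pi_1},\dots,\mathcal M_n^{\pi_n},\mathcal F)$, and the commitment gap is $\mathrm{CG}(\mathbb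 I)=\min_{\mathcal P}\mathrm{OPT}(\mathbb I_{|\mathcal P})/\mathrm{OPT}(\mathbb I)$. For $y\in\mathbb R$, in the local game $(\mathcal M,y)$ a policy advances $\mathcal M$ for some number of steps and then accepts either an outside option of deterministic cost $y$ or a terminal state of $\mathcal M$; $f_{\mathcal M}(y)$ is its minimum expected total cost (the optimality curve). A commitment $\pi$ is an $\alpha$-local approximation for $\mathcal M$ ($\alpha\ge1$) if $f_{\mathcal M^\pi}(\alpha y)\le\alpha f_{\mathcal M}(y)$ for all $y\in\mathbb R$. *)

theory Defs
  imports "HOL-Probability.Probability"
begin

record ('s, 'a) ci_mdp =
  mstates :: "'s set"
  mstart :: 's
  macts :: "'s \<Rightarrow> 'a set"
  mcost :: "'a \<Rightarrow> real"
  mtrans :: "'s \<Rightarrow> 'a \<Rightarrow> 's pmf"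
  mval :: "'s \<Rightarrow> real measure"
  mterm :: "'s set"

abbreviation nonterm :: "('s, 'a) ci_mdp \<Rightarrow> 's set" where
  "nonterm M \<equiv> mstates M - mterm M"

definition mean_val :: "('s, 'a) ci_mdp \<Rightarrow> 's \<Rightarrow> real" where
  "mean_val M s = (\<integral>x. x \<partial>mval M s)"

definition transition_graph :: "('s, 'a) ci_mdp \<Rightarrow> ('s \<times> 's) set" where
  "transition_graph M =
     {(s, s'). s \<in> nonterm M \<and> (\<exists>a\<in>macts M s. s' \<in> set_pmf (mtrans M s a))}"

text \<open>
  The last conjunct says that the laws \<open>mval M s\<close> are the conditional laws of one underlying
  random variable: by the law of total probability, the law in \<open>s\<close> is the average of the laws in
  the successor states, whichever action is taken. The horizon is bounded because the
  state set is finite and the transition graph is acyclic. The action set and transitions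
  recorded for a terminal state are never used.
\<close>
definition costly_info_mdp :: "('s, 'a) ci_mdp \<Rightarrow> bool" where
  "costly_info_mdp M \<longleftrightarrow>
     finite (mstates M) \<and> mstart M \<in> mstates M \<and> mterm M \<subseteq> mstates M \<and>
     (\<forall>s\<in>nonterm M. finite (macts M s) \<and> macts M s \<noteq> {} \<and>
        (\<forall>a\<in>macts M s. 0 \<le> mcost M a \<and> set_pmf (mtrans M s a) \<subseteq> mstates M)) \<and>
     acyclic (transition_graph M) \<and>
     (\<forall>s\<in>mstates M. prob_space (mval M s) \<and> sets (mval M s) = sets borel \<and>
        (AE x in mval M s. 0 \<le> x) \<and> integrable (mval M s) (\<lambda>x. x)) \<and>
     (\<forall>s\<in>nonterm M. \<forall>a\<in>macts M s. \<forall>B\<in>sets borel.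
        measure (mval M s) B =
          (\<Sum>s'\<in>mstates M. pmf (mtrans M s a) s' * measure (mval M s') B))"

definition matroid :: "'e set \<Rightarrow> ('e set \<Rightarrow> bool) \<Rightarrow> bool" where
  "matroid E indep \<longleftrightarrow>
     finite E \<and> (\<forall>X. indep X \<longrightarrow> X \<subseteq> E) \<and> indep {} \<and>
     (\<forall>X Y. indep Y \<and> X \<subseteq> Y \<longrightarrow> indep X) \<and>
     (\<forall>X Y. indep X \<and> indep Y \<and> card X < card Y \<longrightarrow> (\<exists>e\<in>Y - X. indep (insert e X)))"

definition basis_of :: "('e set \<Rightarrow> bool) \<Rightarrow> 'e set \<Rightarrow> bool" where
  "basis_of indep B \<longleftrightarrow> indep B \<and> (\<forall>X. indep X \<and> B \<subseteq> X \<longrightarrow> X = B)"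

definition containing_basis :: "'e set \<Rightarrow> ('e set \<Rightarrow> bool) \<Rightarrow> 'e set set" where
  "containing_basis E indep = {X. X \<subseteq> E \<and> (\<exists>B. basis_of indep B \<and> B \<subseteq> X)}"

definition matroid_min_cics :: "nat \<Rightarrow> (nat \<Rightarrow> ('s, 'a) ci_mdp) \<Rightarrow> nat set set \<Rightarrow> bool" where
  "matroid_min_cics n M F \<longleftrightarrow>
     (\<forall>i\<in>{1..n}. costly_info_mdp (M i)) \<and>
     (\<exists>indep. matroid {1..n} indep \<and> F = containing_basis {1..n} indep)"

text \<open>
  A policy is a decision tree: the choice made at a node may depend on everything observed on
  the way to it. \<open>Toss p P Q\<close> continues as \<open>P\<close> with probability \<open>p\<close> and as \<open>Q\<close> otherwise;
  since only finitely many moves are available at any time, these coin tosses generate all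
  randomised choices of a move.
\<close>
datatype ('s, 'a) policy =
    Stop
  | Accept nat "('s, 'a) policy"
  | Advance nat 'a "'s \<Rightarrow> ('s, 'a) policy"
  | Toss real "('s, 'a) policy" "('s, 'a) policy"

text \<open>Below, \<open>q i\<close> is the current state of the \<open>i\<close>-th MDP and \<open>X\<close> is the set of accepted MDPs.\<close>
primrec valid_policy ::
  "nat \<Rightarrow> (nat \<Rightarrow> ('s, 'a) ci_mdp) \<Rightarrow> nat set set \<Rightarrow> ('s, 'a) policy \<Rightarrow> (nat \<Rightarrow> 's) \<Rightarrow> nat set \<Rightarrow> bool"
where
  "valid_policy n M F Stop q X \<longleftrightarrow> X \<in> F"
| "valid_policy n M F (Accept i P) q X \<longleftrightarrow>
     X \<notin> F \<and> i \<in> {1..n} - X \<and> q i \<in> mterm (M i) \<and> valid_policy n M F P q (insert i X)"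
| "valid_policy n M F (Advance i a P) q X \<longleftrightarrow>
     X \<notin> F \<and> i \<in> {1..n} - X \<and> q i \<in> nonterm (M i) \<and> a \<in> macts (M i) (q i) \<and>
     (\<forall>s\<in>set_pmf (mtrans (M i) (q i) a). valid_policy n M F (P s) (q(i := s)) X)"
| "valid_policy n M F (Toss p P Q) q X \<longleftrightarrow>
     0 \<le> p \<and> p \<le> 1 \<and> valid_policy n M F P q X \<and> valid_policy n M F Q q X"

primrec policy_cost ::
  "(nat \<Rightarrow> ('s, 'a) ci_mdp) \<Rightarrow> ('s, 'a) policy \<Rightarrow> (nat \<Rightarrow> 's) \<Rightarrow> real"
where
  "policy_cost M Stop q = 0"
| "policy_cost M (Accept i P) q = mean_val (M i) (q i) + policy_cost M P q"
| "policy_cost M (Advance i a P) q =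
     mcost (M i) a +
     measure_pmf.expectation (mtrans (M i) (q i) a) (\<lambda>s. policy_cost M (P s) (q(i := s)))"
| "policy_cost M (Toss p P Q) q = p * policy_cost M P q + (1 - p) * policy_cost M Q q"

definition OPT :: "nat \<Rightarrow> (nat \<Rightarrow> ('s, 'a) ci_mdp) \<Rightarrow> nat set set \<Rightarrow> real" where
  "OPT n M F =
     (INF P\<in>{P. valid_policy n M F P (\<lambda>i. mstart (M i)) {}}. policy_cost M P (\<lambda>i. mstart (M i)))"

definition commitment :: "('s, 'a) ci_mdp \<Rightarrow> ('s \<Rightarrow> 'a pmf) \<Rightarrow> bool" where
  "commitment M \<pi> \<longleftrightarrow> (\<forall>s\<in>nonterm M. set_pmf (\<pi> s) \<subseteq> macts M s)"

text \<open>
  In the Markov chain given by a commitment the only action in state \<open>s\<close> is written \<open>s\<close> itself.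
  Its cost is the mean cost of the action drawn from \<open>\<pi> s\<close>; only expected costs are ever
  considered.
\<close>
definition committed :: "('s, 'a) ci_mdp \<Rightarrow> ('s \<Rightarrow> 'a pmf) \<Rightarrow> ('s, 's) ci_mdp" where
  "committed M \<pi> =
     \<lparr>mstates = mstates M, mstart = mstart M,
      macts = (\<lambda>s. {s}),
      mcost = (\<lambda>s. measure_pmf.expectation (\<pi> s) (mcost M)),
      mtrans = (\<lambda>s _. bind_pmf (\<pi> s) (mtrans M s)),
      mval = mval M, mterm = mterm M\<rparr>"

text \<open>
  The infima in this theory are minima: deterministic policies suffice, and there are finitely
  many of them up to irrelevant choices, so the optimum is also continuous in the commitment
  probabilities.
  The ratio is taken in the extended reals, where \<open>x / 0 = \<infinity>\<close> for \<open>x > 0\<close> and \<open>0 / 0 = 0\<close>.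
  Thus a bound on the gap remains meaningful when the optimum is \<open>0\<close>.
\<close>
definition commitment_gap :: "nat \<Rightarrow> (nat \<Rightarrow> ('s, 'a) ci_mdp) \<Rightarrow> nat set set \<Rightarrow> ereal" where
  "commitment_gap n M F =
     (INF \<P>\<in>{\<P>. \<forall>i\<in>{1..n}. commitment (M i) (\<P> i)}.
        ereal (OPT n (\<lambda>i. committed (M i) (\<P> i)) F) / ereal (OPT n M F))"

datatype ('s, 'a) local_policy =
    Take_Outside
  | Take_Terminal
  | Local_Advance 'a "'s \<Rightarrow> ('s, 'a) local_policy"
  | Local_Toss real "('s, 'a) local_policy" "('s, 'a) local_policy"

primrec valid_local :: "('s, 'a) ci_mdp \<Rightarrow> ('s, 'a) local_policy \<Rightarrow> 's \<Rightarrow> bool" where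
  "valid_local M Take_Outside s \<longleftrightarrow> True"
| "valid_local M Take_Terminal s \<longleftrightarrow> s \<in> mterm M"
| "valid_local M (Local_Advance a P) s \<longleftrightarrow>
     s \<in> nonterm M \<and> a \<in> macts M s \<and> (\<forall>s'\<in>set_pmf (mtrans M s a). valid_local M (P s') s')"
| "valid_local M (Local_Toss p P Q) s \<longleftrightarrow>
     0 \<le> p \<and> p \<le> 1 \<and> valid_local M P s \<and> valid_local M Q s"

primrec local_cost :: "('s, 'a) ci_mdp \<Rightarrow> real \<Rightarrow> ('s, 'a) local_policy \<Rightarrow> 's \<Rightarrow> real" where
  "local_cost M y Take_Outside s = y"
| "local_cost M y Take_Terminal s = mean_val M s"
| "local_cost M y (Local_Advance a P) s =
     mcost M a + measure_pmf.expectation (mtrans M s a) (\<lambda>s'. local_cost M y (P s') s')"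
| "local_cost M y (Local_Toss p P Q) s = p * local_cost M y P s + (1 - p) * local_cost M y Q s"

definition optimality_curve :: "('s, 'a) ci_mdp \<Rightarrow> real \<Rightarrow> real" where
  "optimality_curve M y = (INF P\<in>{P. valid_local M P (mstart M)}. local_cost M y P (mstart M))"

definition local_approximation :: "real \<Rightarrow> ('s, 'a) ci_mdp \<Rightarrow> ('s \<Rightarrow> 'a pmf) \<Rightarrow> bool" where
  "local_approximation \<alpha> M \<pi> \<longleftrightarrow>
     commitment M \<pi> \<and>
     (\<forall>y. optimality_curve (committed M \<pi>) (\<alpha> * y) \<le> \<alpha> * optimality_curve M y)"

end

theory Submission
  imports Defs
begin

text \<open>
  Give every state \<open>s\<close> of \<open>M\<^sub>i\<close> a random surrogate weight \<open>W\<close> whose truncated mean \<open>E (min W y)\<close>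
  is the value at \<open>y\<close> of the optimality curve of the local game started in \<open>s\<close>, and let \<open>G\<close> be the
  expected cheapest completion of the accepted set to a basis, for independent surrogate weights
  of the current states. As a function of the weight of one element, the cheapest completion has
  the form \<open>const + min w t\<close>, so the effect of one move on \<open>G\<close> can be read off the optimality
  curve of the MDP that moves.

  For arbitrary MDPs no move decreases \<open>G\<close> in expectation by more than its cost, hence every
  policy costs at least \<open>G\<close>. In Markov chains, advancing or accepting an element of least Gittins
  index among those outside the closure of the accepted set decreases \<open>G\<close> by at least the
  cost, because the threshold \<open>t\<close> is then at least that index; hence some policy costs at most
  \<open>G\<close>. A local approximation bounds the truncated means of the surrogates of the committed chain
  by those of \<open>\<alpha> W\<close>, and exchanging the weights one at a time compares the two values of \<open>G\<close>.

  The surrogates only live on a finite grid, which contains all indices of the chains: truncated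
  means are affine between consecutive grid points, so inequalities on the grid suffice.
\<close>

section \<open>Truncated means and surrogates on a finite grid\<close>

lemma expectation_mono:
  fixes f g :: "'b \<Rightarrow> real"
  assumes "finite (set_pmf p)" "\<And>x. x \<in> set_pmf p \<Longrightarrow> f x \<le> g x"
  shows "measure_pmf.expectation p f \<le> measure_pmf.expectation p g"
  by (rule integral_mono_AE)
    (use assms in \<open>auto simp: integrable_measure_pmf_finite AE_measure_pmf_iff\<close>)

lemma expectation_cong:
  fixes f g :: "'b \<Rightarrow> real"
  assumes "\<And>x. x \<in> set_pmf p \<Longrightarrow> f x = g x"
  shows "measure_pmf.expectation p f = measure_pmf.expectation p g"
  by (rule integral_cong_AE) (use assms in \<open>auto simp: AE_measure_pmf_iff\<close>)

lemma expectation_add: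
  fixes f g :: "'b \<Rightarrow> real"
  assumes "finite (set_pmf p)"
  shows "measure_pmf.expectation p (\<lambda>x. f x + g x) =
    measure_pmf.expectation p f + measure_pmf.expectation p g"
  using assms by (simp add: integrable_measure_pmf_finite)

lemma expectation_nonneg:
  fixes f :: "'b \<Rightarrow> real"
  assumes "\<And>x. x \<in> set_pmf p \<Longrightarrow> 0 \<le> f x"
  shows "0 \<le> measure_pmf.expectation p f"
  by (rule integral_nonneg_AE) (use assms in \<open>auto simp: AE_measure_pmf_iff\<close>)

lemma expectation_swap:
  fixes f :: "'b \<Rightarrow> 'c \<Rightarrow> real"
  assumes "finite (set_pmf p)" "finite (set_pmf q)"
  shows "measure_pmf.expectation p (\<lambda>x. measure_pmf.expectation q (f x)) =
    measure_pmf.expectation q (\<lambda>y. measure_pmf.expectation p (\<lambda>x. f x y))"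
proof -
  have "measure_pmf.expectation p (\<lambda>x. measure_pmf.expectation q (f x)) =
      (\<Sum>x\<in>set_pmf p. \<Sum>y\<in>set_pmf q. pmf p x * (pmf q y * f x y))"
    using assms by (simp add: integral_measure_pmf_real sum_distrib_left mult_ac integral_measure_pmf[of "set_pmf p"] integral_measure_pmf[of "set_pmf q"])
  also have "\<dots> = (\<Sum>y\<in>set_pmf q. \<Sum>x\<in>set_pmf p. pmf p x * (pmf q y * f x y))"
    by (rule sum.swap)
  also have "\<dots> = measure_pmf.expectation q (\<lambda>y. measure_pmf.expectation p (\<lambda>x. f x y))"
    using assms by (simp add: sum_distrib_left mult_ac integral_measure_pmf[of "set_pmf p"] integral_measure_pmf[of "set_pmf q"])
  finally show ?thesis .
qed

section \<open>Truncated means and their interpolation between grid points\<close>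

definition capped_mean :: "real pmf \<Rightarrow> real \<Rightarrow> real" where
  "capped_mean W y = measure_pmf.expectation W (\<lambda>w. min w y)"

text \<open>For \<open>w\<close> in \<open>Y\<close>, the function \<open>min w t\<close> of
  \<open>t\<close> has no kink strictly between neighbouring points of \<open>Y\<close>, so there it
  is affine, with coefficients that do not depend on \<open>w\<close>. As \<open>k\<close> is itself
  a grid point, the neighbours of \<open>t\<close> stay at or above \<open>k\<close>; this is what
  later transfers inequalities known only above an index.\<close>

lemma min_interpolation:
  fixes Y :: "real set"
  assumes "finite Y" "k \<in> Y" "k \<le> t"
  obtains l u c where "l \<in> Y" "u \<in> Y" "k \<le> l" "k \<le> u" "0 \<le> c" "c \<le> 1"
    "\<And>w. w \<in> Y \<Longrightarrow> min w t = c * min w l + (1 - c) * min w u"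
proof -
  define l where "l = Max {y \<in> Y. y \<le> t}"
  have l: "l \<in> Y" "l \<le> t" "k \<le> l"
  proof -
    have "l \<in> {y \<in> Y. y \<le> t}"
      unfolding l_def by (rule Max_in) (use assms in auto)
    moreover show "k \<le> l"
      unfolding l_def by (rule Max_ge) (use assms in auto)
    ultimately show "l \<in> Y" "l \<le> t" by auto
  qed
  have l_max: "w \<le> l" if "w \<in> Y" "w \<le> t" for w
    unfolding l_def by (rule Max_ge) (use that assms in auto)
  show thesis
  proof (cases "{y \<in> Y. t < y} = {}")
    \<comment> \<open>Beyond the largest grid point \<open>min w t\<close> no longer depends on
      \<open>t\<close>, so \<open>l\<close> alone suffices.\<close>
    case True
    then have le: "w \<le> l" if "w \<in> Y" for w
      using l_max[OF that] that by force
    show thesis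
      by (rule that[of l l 1]) (use le l in \<open>auto dest!: le\<close>)
  next
    case False
    define u where "u = Min {y \<in> Y. t < y}"
    have "u \<in> {y \<in> Y. t < y}"
      unfolding u_def by (rule Min_in) (use assms False in auto)
    then have u: "u \<in> Y" "t < u" by auto
    have u_min: "u \<le> w" if "w \<in> Y" "t < w" for w
      unfolding u_def by (rule Min_le) (use that assms in auto)
    define c where "c = (u - t) / (u - l)"
    have c: "0 \<le> c" "c \<le> 1"
      using l u unfolding c_def by (simp_all add: divide_le_eq_1_pos)
    have t: "t = c * l + (1 - c) * u"
    proof -
      have "c * (u - l) = u - t"
        using l u unfolding c_def by simp
      then show ?thesis by (simp add: algebra_simps)
    qed
    have "min w t = c * min w l + (1 - c) * min w u" if "w \<in> Y" for w
    proof (cases "w \<le> t")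
      case True
      then show ?thesis
        using l_max[OF that] l u by (simp add: algebra_simps)
    next
      case False
      then show ?thesis
        using u_min[OF that] l u t by (simp add: min_absorb2)
    qed
    then show thesis
      using l u c assms(3) by (intro that[of l u c]) auto
  qed
qed

lemma capped_mean_interpolation:
  assumes "finite Y" "k \<in> Y" "k \<le> t"
  obtains l u c where "l \<in> Y" "u \<in> Y" "k \<le> l" "k \<le> u" "0 \<le> c" "c \<le> 1"
    "\<And>W. set_pmf W \<subseteq> Y \<Longrightarrow>
      capped_mean W t = c * capped_mean W l + (1 - c) * capped_mean W u"
proof -
  obtain l u c where luc: "l \<in> Y" "u \<in> Y" "k \<le> l" "k \<le> u" "0 \<le> c" "c \<le> 1"
    "\<And>w. w \<in> Y \<Longrightarrow> min w t = c * min w l + (1 - c) * min w u"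
    using min_interpolation[OF assms] by metis
  have "capped_mean W t = c * capped_mean W l + (1 - c) * capped_mean W u"
    if W: "set_pmf W \<subseteq> Y" for W
  proof -
    have fin: "finite (set_pmf W)"
      using W assms(1) finite_subset by blast
    have "capped_mean W t = measure_pmf.expectation W (\<lambda>w. c * min w l + (1 - c) * min w u)"
      unfolding capped_mean_def by (rule expectation_cong) (use W luc(7) in auto)
    also have "\<dots> = c * capped_mean W l + (1 - c) * capped_mean W u"
      unfolding capped_mean_def by (simp add: expectation_add[OF fin])
    finally show ?thesis .
  qed
  then show thesis
    using that luc by metis
qed

text \<open>The factor \<open>r\<close> is \<open>1\<close> or \<open>-1\<close>, so that one statement covers both directions of the inequality.\<close>
lemma capped_mean_mixture:
  assumes "finite Y" "k \<in> Y" "k \<le> t"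
    and W: "set_pmf W \<subseteq> Y"
    and p: "finite (set_pmf p)" and V: "\<And>s. s \<in> set_pmf p \<Longrightarrow> set_pmf (V s) \<subseteq> Y"
    and grid: "\<And>y. y \<in> Y \<Longrightarrow> k \<le> y \<Longrightarrow>
      r * capped_mean W y \<le> r * b + r * measure_pmf.expectation p (\<lambda>s. capped_mean (V s) y)"
  shows "r * capped_mean W t \<le> r * b + r * measure_pmf.expectation p (\<lambda>s. capped_mean (V s) t)"
proof -
  obtain l u c where luc: "l \<in> Y" "u \<in> Y" "k \<le> l" "k \<le> u" "0 \<le> c" "c \<le> 1"
    and ip: "\<And>W. set_pmf W \<subseteq> Y \<Longrightarrow>
      capped_mean W t = c * capped_mean W l + (1 - c) * capped_mean W u"
    using capped_mean_interpolation[OF assms(1-3)] by metis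
  have "measure_pmf.expectation p (\<lambda>s. capped_mean (V s) t) =
      measure_pmf.expectation p (\<lambda>s. c * capped_mean (V s) l + (1 - c) * capped_mean (V s) u)"
    by (rule expectation_cong) (use V ip in auto)
  also have "\<dots> = c * measure_pmf.expectation p (\<lambda>s. capped_mean (V s) l) +
      (1 - c) * measure_pmf.expectation p (\<lambda>s. capped_mean (V s) u)"
    by (simp add: expectation_add[OF p])
  finally have eq: "measure_pmf.expectation p (\<lambda>s. capped_mean (V s) t) = \<dots>" .
  have "c * (r * capped_mean W l) + (1 - c) * (r * capped_mean W u) \<le>
      c * (r * b + r * measure_pmf.expectation p (\<lambda>s. capped_mean (V s) l)) +
      (1 - c) * (r * b + r * measure_pmf.expectation p (\<lambda>s. capped_mean (V s) u))"
    using luc by (intro add_mono mult_left_mono grid) auto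
  then show ?thesis
    unfolding eq ip[OF W] by (simp add: algebra_simps)
qed

text \<open>For \<open>W\<close> on the nonnegative reals, \<open>capped_mean W\<close> is concave
  with slope \<open>P(W > y)\<close> to the right of \<open>y\<close>. Conversely, the chord slopes
  of \<open>f\<close> along the grid decrease and lie in \<open>[0,1]\<close>, so they serve as tail
  probabilities. The law is built by inserting the grid points in increasing order, each time moving
  mass from the largest point so far to the new one.\<close>

lemma surrogate_exists:
  fixes f :: "real \<Rightarrow> real"
  assumes Y: "finite Y" "0 \<in> Y" "\<And>y. y \<in> Y \<Longrightarrow> 0 \<le> y"
    and f0: "f 0 = 0"
    and f_le: "\<And>y. 0 \<le> y \<Longrightarrow> f y \<le> y"
    and mono: "\<And>x y. 0 \<le> x \<Longrightarrow> x \<le> y \<Longrightarrow> f x \<le> f y"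
    and concave: "\<And>c x y. 0 \<le> c \<Longrightarrow> c \<le> 1 \<Longrightarrow> 0 \<le> x \<Longrightarrow> 0 \<le> y \<Longrightarrow>
      c * f x + (1 - c) * f y \<le> f (c * x + (1 - c) * y)"
  shows "\<exists>W. set_pmf W \<subseteq> Y \<and> (\<forall>y\<in>Y. capped_mean W y = f y)"
proof -
  \<comment> \<open>The last conjunct of the invariant says that the mass at the current largest
    point bounds the slope of every chord starting there, so enough mass is available for the next
    move. Initially all mass sits at \<open>0\<close>, where \<open>f y \<le> y\<close> gives the
    bound.\<close>
  have "\<exists>W. set_pmf W \<subseteq> insert 0 Z \<and> (\<forall>y\<in>insert 0 Z. capped_mean W y = f y) \<and>
      (\<forall>b > Max (insert 0 Z).
        f b - f (Max (insert 0 Z)) \<le> pmf W (Max (insert 0 Z)) * (b - Max (insert 0 Z)))"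
    if "finite Z" "\<forall>z\<in>Z. 0 < z" for Z
    using that
  proof (induction Z rule: finite_linorder_max_induct)
    case empty
    show ?case
      by (rule exI[of _ "return_pmf 0"]) (use f0 f_le in \<open>auto simp: capped_mean_def\<close>)
  next
    case (insert b Z)
    define m where "m = Max (insert 0 Z)"
    obtain W where W: "set_pmf W \<subseteq> insert 0 Z" "\<And>y. y \<in> insert 0 Z \<Longrightarrow> capped_mean W y = f y"
      "\<And>d. m < d \<Longrightarrow> f d - f m \<le> pmf W m * (d - m)"
      using insert.IH insert.prems unfolding m_def by blast
    have m: "m \<in> insert 0 Z"
      unfolding m_def by (rule Max_in) (use insert.hyps in auto)
    have m_max: "y \<le> m" if "y \<in> insert 0 Z" for y
      unfolding m_def by (rule Max_ge) (use insert.hyps that in auto)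
    have b: "0 < b" "m < b" "b \<notin> insert 0 Z" "0 \<le> m"
      using insert m m_max by auto
    have Max_b: "Max (insert 0 (insert b Z)) = b"
      by (rule Max_eqI) (use insert.hyps b(1) in \<open>auto intro: less_imp_le\<close>)
    define p d where "p = pmf W m" and "d = (f b - f m) / (b - m)"
    have "0 \<le> f b - f m"
      using mono[of m b] b by simp
    then have d: "0 \<le> d" "d \<le> p" "d * (b - m) = f b - f m"
      using W(3)[OF b(2)] b(2) unfolding d_def p_def by (simp_all add: pos_divide_le_eq)
    have "0 \<le> p" unfolding p_def by simp
    then have dp: "0 \<le> d / p" "d / p \<le> 1" "p * (d / p) = d"
      using d by (auto simp: divide_le_eq_1)
    \<comment> \<open>Mass \<open>d\<close>, the slope of the new chord, moves from \<open>m\<close>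
      to \<open>b\<close>: a draw of \<open>m\<close> is replaced by \<open>b\<close> with
      probability \<open>d / p\<close>. If \<open>p = 0\<close> then \<open>d = 0\<close> as well,
      and \<open>d / p\<close> is \<open>0\<close> by the convention on division.\<close>
    define W' where "W' = bind_pmf W (\<lambda>w. if w = m
      then map_pmf (\<lambda>h. if h then b else m) (bernoulli_pmf (d / p)) else return_pmf w)"
    have fin: "finite (insert 0 Z)"
      using insert.hyps by simp
    have finW: "finite (set_pmf W)"
      using W(1) fin finite_subset by blast
    have E: "measure_pmf.expectation W' h = measure_pmf.expectation W h + d * (h b - h m)"
      for h :: "real \<Rightarrow> real"
    proof -
      have "measure_pmf.expectation W' h =
          (\<Sum>w\<in>insert 0 Z. pmf W w * (h w + (if w = m then d / p * (h b - h m) else 0)))"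
        unfolding W'_def
        by (subst pmf_expectation_bind[OF fin _ W(1)])
          (use dp(1,2) in \<open>auto intro!: sum.cong simp: algebra_simps\<close>)
      also have "\<dots> = (\<Sum>w\<in>insert 0 Z. pmf W w * h w) +
          (\<Sum>w\<in>insert 0 Z. if w = m then pmf W w * (d / p * (h b - h m)) else 0)"
        by (subst sum.distrib[symmetric]) (auto intro!: sum.cong simp: algebra_simps)
      also have "(\<Sum>w\<in>insert 0 Z. if w = m then pmf W w * (d / p * (h b - h m)) else 0) =
          d * (h b - h m)"
        using m fin dp(3) unfolding p_def
        by (simp add: mult.assoc[symmetric] del: times_divide_eq_right times_divide_eq_left insert_iff)
      also have "(\<Sum>w\<in>insert 0 Z. pmf W w * h w) = measure_pmf.expectation W h"
        using W(1) fin by (subst integral_measure_pmf[of "insert 0 Z"]) auto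
      finally show ?thesis .
    qed
    have supp: "set_pmf W' \<subseteq> insert 0 (insert b Z)"
      unfolding W'_def using W(1) m by (auto split: if_splits)
    have old: "capped_mean W' y = f y" if y: "y \<in> insert 0 Z" for y
      using W(2)[OF y] m_max[OF y] b unfolding capped_mean_def E by simp
    have "measure_pmf.expectation W (\<lambda>w. min w b) = measure_pmf.expectation W (\<lambda>w. min w m)"
      by (rule expectation_cong) (use W(1) m_max b in force)
    then have new: "capped_mean W' b = f b"
      using W(2)[OF m] d(3) b unfolding capped_mean_def E by simp
    have "pmf W' b = measure_pmf.expectation W' (indicator {b})"
      by (simp add: pmf.rep_eq)
    also have "\<dots> = measure_pmf.expectation W (indicator {b}) + d"
      unfolding E using b by simp
    also have "measure_pmf.expectation W (indicator {b}) = measure_pmf.expectation W (\<lambda>_. 0::real)"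
      by (rule expectation_cong) (use W(1) b(3) in \<open>auto simp: indicator_def\<close>)
    finally have "pmf W' b = d" by simp
    \<comment> \<open>To restore the invariant, \<open>b\<close> is written as a convex combination
      of \<open>m\<close> and \<open>e\<close>; concavity then says that the chord from
      \<open>b\<close> to \<open>e\<close> is no steeper than the one from \<open>m\<close> to
      \<open>b\<close>.\<close>
    moreover have "f e - f b \<le> d * (e - b)" if e: "b < e" for e
    proof -
      define c where "c = (e - b) / (e - m)"
      have "m < e"
        using b e by simp
      then have ce: "c * (e - m) = e - b" and c: "0 \<le> c" "c \<le> 1"
        using b e unfolding c_def by (simp_all add: divide_le_eq_1_pos)
      have "c * m + (1 - c) * e = b"
        using ce by (simp add: algebra_simps)
      then have "c * f m + (1 - c) * f e \<le> f b"
        using concave[OF c, of m e] b e by simp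
      then have "(c * f m + (1 - c) * f e) * (e - m) \<le> f b * (e - m)"
        using b e by (intro mult_right_mono) auto
      moreover have "(c * f m + (1 - c) * f e) * (e - m) = (e - b) * f m + (b - m) * f e"
      proof -
        have "(c * f m + (1 - c) * f e) * (e - m) =
            (c * (e - m)) * f m + ((e - m) - c * (e - m)) * f e"
          by (simp add: algebra_simps)
        then show ?thesis unfolding ce by simp
      qed
      ultimately have "(b - m) * (f e - f b) \<le> (e - b) * (f b - f m)"
        by (simp add: algebra_simps)
      then have "f e - f b \<le> (e - b) * (f b - f m) / (b - m)"
        using b by (simp add: pos_le_divide_eq mult.commute)
      then show ?thesis
        unfolding d_def by (simp add: mult.commute)
    qed
    ultimately show ?case
      unfolding Max_b using supp old new
      by (intro exI[of _ W'] conjI ballI allI impI) auto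
  qed
  moreover have "finite (Y - {0})" "\<forall>y\<in>Y - {0}. 0 < y"
    using Y(1,3) by (auto simp: order_less_le)
  moreover have "insert 0 (Y - {0}) = Y"
    using Y(2) by blast
  ultimately show ?thesis
    by metis
qed

section \<open>Optimality curves\<close>

locale finite_mdp =
  fixes M :: "('s, 'a) ci_mdp"
  assumes finite_states: "finite (mstates M)"
    and start_state: "mstart M \<in> mstates M"
    and term_states: "mterm M \<subseteq> mstates M"
    and acts_nonempty: "\<And>s. s \<in> nonterm M \<Longrightarrow> macts M s \<noteq> {}"
    and finite_acts: "\<And>s. s \<in> nonterm M \<Longrightarrow> finite (macts M s)"
    and cost_nonneg: "\<And>s a. s \<in> nonterm M \<Longrightarrow> a \<in> macts M s \<Longrightarrow> 0 \<le> mcost M a"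
    and trans_states: "\<And>s a. s \<in> nonterm M \<Longrightarrow> a \<in> macts M s \<Longrightarrow> set_pmf (mtrans M s a) \<subseteq> mstates M"
    and acyclic_transitions: "acyclic (transition_graph M)"
    and val_nonneg: "\<And>s. s \<in> mterm M \<Longrightarrow> 0 \<le> mean_val M s"

lemma finite_mdp_if_costly_info_mdp:
  assumes "costly_info_mdp M"
  shows "finite_mdp M"
proof
  fix s assume "s \<in> mterm M"
  then have "s \<in> mstates M"
    using assms unfolding costly_info_mdp_def by auto
  then have "AE x in mval M s. 0 \<le> x"
    using assms unfolding costly_info_mdp_def by auto
  then show "0 \<le> mean_val M s"
    unfolding mean_val_def by (rule integral_nonneg_AE)
qed (use assms in \<open>auto simp: costly_info_mdp_def\<close>)

text \<open>A commitment draws only available actions, so mean costs stay nonnegative and the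
  transition graph of the chain is a subgraph of the original one. Thus all facts on curves apply to
  the MDPs and to the committed chains alike.\<close>

lemma finite_mdp_committed:
  assumes "finite_mdp M" "commitment M \<pi>"
  shows "finite_mdp (committed M \<pi>)"
proof -
  interpret finite_mdp M by fact
  have \<pi>: "set_pmf (\<pi> s) \<subseteq> macts M s" if "s \<in> nonterm M" for s
    using assms(2) that unfolding commitment_def by blast
  have sub: "transition_graph (committed M \<pi>) \<subseteq> transition_graph M"
    using \<pi> unfolding transition_graph_def committed_def by fastforce
  show ?thesis
  proof
    fix s a
    assume "s \<in> nonterm (committed M \<pi>)" "a \<in> macts (committed M \<pi>) s"
    then have a: "a = s" and s: "s \<in> nonterm M"
      by (auto simp: committed_def)
    show "0 \<le> mcost (committed M \<pi>) a"
      using \<pi>[OF s] cost_nonneg[OF s] unfolding a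
      by (auto simp: committed_def intro!: expectation_nonneg)
    show "set_pmf (mtrans (committed M \<pi>) s a) \<subseteq> mstates (committed M \<pi>)"
      using \<pi>[OF s] trans_states[OF s] by (auto simp: committed_def)
  next
    show "acyclic (transition_graph (committed M \<pi>))"
      using acyclic_transitions sub by (rule acyclic_subset)
  qed (use finite_states start_state term_states val_nonneg in
      \<open>auto simp: committed_def mean_val_def\<close>)
qed

section \<open>Shape of the optimality curve\<close>

primrec outside_prob :: "('s, 'a) ci_mdp \<Rightarrow> ('s, 'a) local_policy \<Rightarrow> 's \<Rightarrow> real" where
  "outside_prob M Take_Outside s = 1"
| "outside_prob M Take_Terminal s = 0"
| "outside_prob M (Local_Advance a P) s =
     measure_pmf.expectation (mtrans M s a) (\<lambda>s'. outside_prob M (P s') s')"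
| "outside_prob M (Local_Toss p P Q) s = p * outside_prob M P s + (1 - p) * outside_prob M Q s"

definition curve :: "('s, 'a) ci_mdp \<Rightarrow> 's \<Rightarrow> real \<Rightarrow> real" where
  "curve M s y = (INF P\<in>{P. valid_local M P s}. local_cost M y P s)"

lemma curve_start: "curve M (mstart M) = optimality_curve M"
  unfolding curve_def optimality_curve_def by auto

context finite_mdp
begin

lemma finite_trans: "s \<in> nonterm M \<Longrightarrow> a \<in> macts M s \<Longrightarrow> finite (set_pmf (mtrans M s a))"
  using trans_states finite_states finite_subset by metis

text \<open>The outside cost enters with the probability of being taken. Hence \<open>curve\<close>
  is an infimum of lines with slopes in \<open>[0,1]\<close>, which is the source of its
  monotonicity, Lipschitz bound and concavity.\<close>

lemma local_cost_affine:
  assumes "valid_local M P s"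
  shows "local_cost M y P s = local_cost M 0 P s + outside_prob M P s * y"
  using assms
proof (induction P arbitrary: s)
  case (Local_Advance a P)
  then have fin: "finite (set_pmf (mtrans M s a))"
    using finite_trans by auto
  have "measure_pmf.expectation (mtrans M s a) (\<lambda>s'. local_cost M y (P s') s') =
      measure_pmf.expectation (mtrans M s a)
        (\<lambda>s'. local_cost M 0 (P s') s' + outside_prob M (P s') s' * y)"
    by (rule expectation_cong) (use Local_Advance in auto)
  then show ?case
    by (simp add: expectation_add[OF fin])
qed (auto simp: algebra_simps)

lemma outside_prob_bounds:
  assumes "valid_local M P s"
  shows "0 \<le> outside_prob M P s" "outside_prob M P s \<le> 1"
proof -
  have "0 \<le> outside_prob M P s \<and> outside_prob M P s \<le> 1"
    using assms
  proof (induction P arbitrary: s)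
    case (Local_Advance a P)
    then have fin: "finite (set_pmf (mtrans M s a))"
      using finite_trans by auto
    have "measure_pmf.expectation (mtrans M s a) (\<lambda>s'. outside_prob M (P s') s') \<le>
        measure_pmf.expectation (mtrans M s a) (\<lambda>_. 1)"
      by (rule expectation_mono[OF fin]) (use Local_Advance in auto)
    moreover have "0 \<le> measure_pmf.expectation (mtrans M s a) (\<lambda>s'. outside_prob M (P s') s')"
      by (rule expectation_nonneg) (use Local_Advance in auto)
    ultimately show ?case by simp
  next
    case (Local_Toss p P Q)
    then show ?case
      using convex_bound_le[of "outside_prob M P s" 1 "outside_prob M Q s" p "1 - p"] by auto
  qed auto
  then show "0 \<le> outside_prob M P s" "outside_prob M P s \<le> 1" by auto
qed

lemma local_cost_nonneg:
  assumes "valid_local M P s" "0 \<le> y"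
  shows "0 \<le> local_cost M y P s"
  using assms
proof (induction P arbitrary: s)
  case (Local_Advance a P)
  have "0 \<le> measure_pmf.expectation (mtrans M s a) (\<lambda>s'. local_cost M y (P s') s')"
    by (rule expectation_nonneg) (use Local_Advance in auto)
  then show ?case
    using Local_Advance.prems cost_nonneg[of s a] by auto
qed (auto simp: val_nonneg)

lemma curve_le:
  assumes "valid_local M P s" "0 \<le> y"
  shows "curve M s y \<le> local_cost M y P s"
  unfolding curve_def
  by (rule cINF_lower) (use assms local_cost_nonneg in \<open>auto intro!: bdd_belowI2[of _ 0]\<close>)

lemma curve_ge:
  assumes "\<And>P. valid_local M P s \<Longrightarrow> c \<le> local_cost M y P s"
  shows "c \<le> curve M s y"
  unfolding curve_def by (rule cINF_greatest) (use assms in \<open>auto intro: exI[of _ Take_Outside]\<close>)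

lemma curve_nonneg: "0 \<le> y \<Longrightarrow> 0 \<le> curve M s y"
  by (rule curve_ge) (rule local_cost_nonneg)

lemma curve_le_outside: "0 \<le> y \<Longrightarrow> curve M s y \<le> y"
  using curve_le[of Take_Outside s y] by simp

lemma curve_0: "curve M s 0 = 0"
  using curve_nonneg[of 0 s] curve_le_outside[of 0 s] by simp

lemma curve_mono:
  assumes "0 \<le> x" "x \<le> y"
  shows "curve M s x \<le> curve M s y"
proof (rule curve_ge)
  fix P assume P: "valid_local M P s"
  have "outside_prob M P s * x \<le> outside_prob M P s * y"
    using outside_prob_bounds[OF P] assms by (intro mult_left_mono) auto
  then show "curve M s x \<le> local_cost M y P s"
    using curve_le[OF P assms(1)] local_cost_affine[OF P, of x] local_cost_affine[OF P, of y]
    by linarith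
qed

lemma curve_lipschitz:
  assumes "0 \<le> x" "x \<le> y"
  shows "curve M s y \<le> curve M s x + (y - x)"
proof -
  have "curve M s y - (y - x) \<le> curve M s x"
  proof (rule curve_ge)
    fix P assume P: "valid_local M P s"
    have "outside_prob M P s * (y - x) \<le> 1 * (y - x)"
      using outside_prob_bounds[OF P] assms by (intro mult_right_mono) auto
    moreover have "curve M s y \<le> local_cost M y P s"
      using curve_le[OF P] assms by simp
    ultimately show "curve M s y - (y - x) \<le> local_cost M x P s"
      using local_cost_affine[OF P, of x] local_cost_affine[OF P, of y]
      by (simp add: algebra_simps)
  qed
  then show ?thesis by simp
qed

lemma curve_concave:
  assumes "0 \<le> c" "c \<le> 1" "0 \<le> x" "0 \<le> y"
  shows "c * curve M s x + (1 - c) * curve M s y \<le> curve M s (c * x + (1 - c) * y)"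
proof (rule curve_ge)
  fix P assume P: "valid_local M P s"
  have "c * curve M s x + (1 - c) * curve M s y \<le>
      c * local_cost M x P s + (1 - c) * local_cost M y P s"
    using assms curve_le[OF P] by (intro add_mono mult_left_mono) auto
  also have "\<dots> = local_cost M (c * x + (1 - c) * y) P s"
    using local_cost_affine[OF P, of x] local_cost_affine[OF P, of y]
      local_cost_affine[OF P, of "c * x + (1 - c) * y"] by (simp add: algebra_simps)
  finally show "c * curve M s x + (1 - c) * curve M s y \<le> local_cost M (c * x + (1 - c) * y) P s" .
qed

section \<open>One-step relations for curves and the Gittins index\<close>

lemma curve_terminal:
  assumes "s \<in> mterm M" "0 \<le> y"
  shows "curve M s y = min y (mean_val M s)"
proof (rule antisym)
  show "curve M s y \<le> min y (mean_val M s)"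
    using curve_le[of Take_Outside s y] curve_le[of Take_Terminal s y] assms by simp
  have "min y (mean_val M s) \<le> local_cost M y P s" if "valid_local M P s" for P
    using that
  proof (induction P)
    case (Local_Toss p P Q)
    then have "(p + (1 - p)) * min y (mean_val M s) \<le>
        p * local_cost M y P s + (1 - p) * local_cost M y Q s"
      unfolding distrib_right by (intro add_mono mult_left_mono) auto
    then show ?case by simp
  qed (use assms in auto)
  then show "min y (mean_val M s) \<le> curve M s y"
    by (rule curve_ge)
qed

text \<open>Playing \<open>a\<close> and then a nearly optimal policy in each successor is one valid
  policy. The slack \<open>\<epsilon>\<close> stands in for attainment of the infima.\<close>

lemma curve_advance_le:
  assumes s: "s \<in> nonterm M" "a \<in> macts M s" and y: "0 \<le> y"
  shows "curve M s y \<le>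
    mcost M a + measure_pmf.expectation (mtrans M s a) (\<lambda>s'. curve M s' y)"
proof (rule field_le_epsilon)
  fix \<epsilon> :: real assume "0 < \<epsilon>"
  have "\<exists>P. valid_local M P s' \<and> local_cost M y P s' < curve M s' y + \<epsilon>" for s'
  proof (rule ccontr)
    assume "\<not> ?thesis"
    then have "curve M s' y + \<epsilon> \<le> curve M s' y"
      by (intro curve_ge) force
    with \<open>0 < \<epsilon>\<close> show False by simp
  qed
  then obtain P where P: "\<And>s'. valid_local M (P s') s'"
      "\<And>s'. local_cost M y (P s') s' < curve M s' y + \<epsilon>"
    by metis
  have "curve M s y \<le> local_cost M y (Local_Advance a P) s"
    by (rule curve_le) (use s y P in auto)
  also have "\<dots> \<le> mcost M a +
      measure_pmf.expectation (mtrans M s a) (\<lambda>s'. curve M s' y + \<epsilon>)"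
    unfolding local_cost.simps
    by (intro add_left_mono expectation_mono finite_trans s less_imp_le P(2))
  also have "\<dots> = mcost M a + measure_pmf.expectation (mtrans M s a) (\<lambda>s'. curve M s' y) + \<epsilon>"
    by (simp add: expectation_add[OF finite_trans[OF s]])
  finally show "curve M s y \<le>
    mcost M a + measure_pmf.expectation (mtrans M s a) (\<lambda>s'. curve M s' y) + \<epsilon>" .
qed

text \<open>With a single action, a valid policy in a nonterminal state takes the outside option,
  plays \<open>a\<close> first, or tosses a coin between such policies, and an average is never
  below the minimum.\<close>

lemma curve_chain_ge:
  assumes s: "s \<in> nonterm M" "macts M s = {a}" and y: "0 \<le> y"
  shows "min y (mcost M a + measure_pmf.expectation (mtrans M s a) (\<lambda>s'. curve M s' y)) \<le>
    curve M s y" (is "?m \<le> _")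
proof (rule curve_ge)
  fix P assume "valid_local M P s"
  then show "?m \<le> local_cost M y P s"
  proof (induction P)
    case (Local_Advance b P)
    then have "b = a" using s by simp
    then have "measure_pmf.expectation (mtrans M s a) (\<lambda>s'. curve M s' y) \<le>
        measure_pmf.expectation (mtrans M s a) (\<lambda>s'. local_cost M y (P s') s')"
      using Local_Advance.prems y by (intro expectation_mono finite_trans curve_le) auto
    with \<open>b = a\<close> show ?case by simp
  next
    case (Local_Toss p P Q)
    then have "(p + (1 - p)) * ?m \<le> p * local_cost M y P s + (1 - p) * local_cost M y Q s"
      unfolding distrib_right by (intro add_mono mult_left_mono) auto
    then show ?case by simp
  qed (use s in auto)
qed

lemma finite_transition_graph: "finite (transition_graph M)"
proof (rule finite_subset)
  show "transition_graph M \<subseteq> mstates M \<times> mstates M"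
    using trans_states unfolding transition_graph_def by fastforce
qed (simp add: finite_states)

lemma wf_transitions: "wf ((transition_graph M)\<inverse>)"
  using finite_transition_graph acyclic_transitions by (rule finite_acyclic_wf_converse)

text \<open>Advancing until a terminal state is reached never pays for the outside option, so its
  cost bounds the curve uniformly in \<open>y\<close>. The bound closes the interval on which the
  index is found as a fixed point.\<close>

lemma curve_bounded:
  assumes "s \<in> mstates M"
  shows "\<exists>K. \<forall>y\<ge>0. curve M s y \<le> K"
  using assms
proof (induction s rule: wf_induct_rule[OF wf_transitions])
  case (1 s)
  show ?case
  proof (cases "s \<in> mterm M")
    case True
    then show ?thesis
      by (intro exI[of _ "mean_val M s"]) (simp add: curve_terminal)
  next
    case False
    then have s: "s \<in> nonterm M"
      using 1(2) by simp
    obtain a where a: "a \<in> macts M s"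
      using acts_nonempty[OF s] by blast
    have "\<exists>K. \<forall>y\<ge>0. curve M s' y \<le> K" if "s' \<in> set_pmf (mtrans M s a)" for s'
      using that trans_states[OF s a] 1(1)[of s'] s a by (auto simp: transition_graph_def)
    then obtain K where K: "\<And>s' y. s' \<in> set_pmf (mtrans M s a) \<Longrightarrow> 0 \<le> y \<Longrightarrow> curve M s' y \<le> K s'"
      by metis
    have "curve M s y \<le> mcost M a + measure_pmf.expectation (mtrans M s a) K" if y: "0 \<le> y" for y
    proof -
      have "measure_pmf.expectation (mtrans M s a) (\<lambda>s'. curve M s' y) \<le>
          measure_pmf.expectation (mtrans M s a) K"
        by (rule expectation_mono[OF finite_trans[OF s a]]) (use K y in auto)
      then show ?thesis
        using curve_advance_le[OF s a y] by simp
    qed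
    then show ?thesis by blast
  qed
qed

lemma curve_continuous: "continuous_on {0..} (curve M s)"
proof (rule lipschitz_on_continuous_on)
  have "\<bar>curve M s x - curve M s y\<bar> \<le> \<bar>x - y\<bar>" if "0 \<le> x" "0 \<le> y" for x y
    using curve_mono[of x y s] curve_mono[of y x s] curve_lipschitz[of x y s]
      curve_lipschitz[of y x s] that by linarith
  then show "1-lipschitz_on {0..} (curve M s)"
    by (intro lipschitz_onI) (auto simp: dist_real_def)
qed

text \<open>The number \<open>k\<close> is the Gittins index: for an outside option above \<open>k\<close> it is optimal to play.\<close>
lemma chain_index:
  assumes s: "s \<in> mstates M" and acts: "\<And>s. s \<in> nonterm M \<Longrightarrow> macts M s = {act s}"
  obtains k where "0 \<le> k" "curve M s k = k"
    "\<And>y. s \<in> mterm M \<Longrightarrow> k \<le> y \<Longrightarrow> mean_val M s \<le> curve M s y"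
    "\<And>y. s \<in> nonterm M \<Longrightarrow> k \<le> y \<Longrightarrow>
      mcost M (act s) + measure_pmf.expectation (mtrans M s (act s)) (\<lambda>s'. curve M s' y)
        \<le> curve M s y"
proof (cases "s \<in> mterm M")
  case True
  then show thesis
    using that[of "mean_val M s"] val_nonneg[OF True] by (auto simp: curve_terminal)
next
  case False
  with s have s: "s \<in> nonterm M" and a: "act s \<in> macts M s"
    using acts by auto
  note fin = finite_trans[OF s a]
  \<comment> \<open>\<open>cont y\<close> is the cost of one forced move followed by optimal play.
    The index will be a fixed point of \<open>cont\<close>, where stopping and moving cost the same;
    it exists by the intermediate value theorem because \<open>cont\<close> is continuous,
    nonnegative at \<open>0\<close> and bounded.\<close>
  define cont where "cont y = mcost M (act s) +
    measure_pmf.expectation (mtrans M s (act s)) (\<lambda>s'. curve M s' y)" for y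
  have cont_0: "0 \<le> cont 0"
    unfolding cont_def using cost_nonneg[OF s a] by (simp add: curve_0)
  have "\<exists>K. \<forall>y\<ge>0. curve M s' y \<le> K" if "s' \<in> set_pmf (mtrans M s (act s))" for s'
    using that trans_states[OF s a] curve_bounded by blast
  then obtain K where K: "\<And>s' y. s' \<in> set_pmf (mtrans M s (act s)) \<Longrightarrow> 0 \<le> y \<Longrightarrow> curve M s' y \<le> K s'"
    by metis
  define b where "b = mcost M (act s) + measure_pmf.expectation (mtrans M s (act s)) K"
  have cont_b: "cont y \<le> b" if "0 \<le> y" for y
    unfolding cont_def b_def
    by (intro add_left_mono expectation_mono[OF fin]) (use K that in auto)
  have b: "0 \<le> b"
    using cont_b[of 0] cont_0 by simp
  have "continuous_on {0..} cont"
    unfolding cont_def integral_measure_pmf[OF fin, of "mtrans M s (act s)", simplified]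
    by (intro continuous_intros curve_continuous)
  then have "continuous_on {0..b} (\<lambda>y. y - cont y)"
    by (intro continuous_intros) (auto elim: continuous_on_subset)
  then obtain k where k: "0 \<le> k" "cont k = k"
    using IVT'[of "\<lambda>y. y - cont y" 0 0 b] cont_0 cont_b[of b] b by force
  \<comment> \<open>From \<open>k\<close> to \<open>y\<close> the function \<open>cont\<close> grows
    by at most \<open>y - k\<close>, so \<open>cont y \<le> y\<close> and the minimum in
    \<open>curve_chain_ge\<close> is \<open>cont y\<close>.\<close>
  have "cont y \<le> curve M s y" if y: "k \<le> y" for y
  proof -
    have "cont y \<le> mcost M (act s) + measure_pmf.expectation (mtrans M s (act s))
        (\<lambda>s'. curve M s' k + (y - k))"
      unfolding cont_def by (auto intro!: expectation_mono[OF fin] curve_lipschitz k y)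
    also have "\<dots> = cont k + (y - k)"
      unfolding cont_def by (simp add: expectation_add[OF fin])
    finally show ?thesis
      using curve_chain_ge[OF s acts[OF s], of y] k y unfolding cont_def by simp
  qed
  moreover have "curve M s k = k"
    using curve_le_outside[of k s] calculation[of k] k by simp
  ultimately show thesis
    using that[of k] k(1) False unfolding cont_def by blast
qed

end

section \<open>Expected minimum completions in a matroid\<close>

lemma expectation_bind:
  fixes h :: "'c \<Rightarrow> real"
  assumes "finite (set_pmf p)" "\<And>x. x \<in> set_pmf p \<Longrightarrow> finite (set_pmf (f x))"
  shows "measure_pmf.expectation (bind_pmf p f) h =
    measure_pmf.expectation p (\<lambda>x. measure_pmf.expectation (f x) h)"
  using assms by (simp add: pmf_expectation_bind[of "set_pmf p"] integral_measure_pmf[of "set_pmf p"])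

lemma finite_set_Pi_pmf:
  assumes "finite A" "\<And>x. x \<in> A \<Longrightarrow> finite (set_pmf (p x))"
  shows "finite (set_pmf (Pi_pmf A d p))"
  using assms by (simp add: set_Pi_pmf finite_PiE_dflt)

lemma expectation_Pi_pmf_split:
  fixes h :: "('e \<Rightarrow> real) \<Rightarrow> real"
  assumes A: "finite A" "i \<in> A" and fin: "\<And>j. j \<in> A \<Longrightarrow> finite (set_pmf (W j))"
  shows "measure_pmf.expectation (Pi_pmf A d W) h =
    measure_pmf.expectation (Pi_pmf (A - {i}) d W)
      (\<lambda>w. measure_pmf.expectation (W i) (\<lambda>x. h (w(i := x))))"
proof -
  have fin': "finite (set_pmf (Pi_pmf (A - {i}) d W))"
    by (rule finite_set_Pi_pmf) (use A fin in auto)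
  have "Pi_pmf A d W = bind_pmf (W i) (\<lambda>x. map_pmf (\<lambda>w. w(i := x)) (Pi_pmf (A - {i}) d W))"
    using Pi_pmf_insert'[of "A - {i}" i d W] A by (simp add: insert_absorb map_pmf_def)
  then have "measure_pmf.expectation (Pi_pmf A d W) h = measure_pmf.expectation (W i)
      (\<lambda>x. measure_pmf.expectation (Pi_pmf (A - {i}) d W) (\<lambda>w. h (w(i := x))))"
    using fin[OF A(2)] fin' by (simp add: expectation_bind)
  also have "\<dots> = measure_pmf.expectation (Pi_pmf (A - {i}) d W)
      (\<lambda>w. measure_pmf.expectation (W i) (\<lambda>x. h (w(i := x))))"
    by (rule expectation_swap[OF fin[OF A(2)] fin'])
  finally show ?thesis .
qed

section \<open>Bases and exchange in a matroid\<close>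

locale matroid_family =
  fixes E :: "'e set" and indep :: "'e set \<Rightarrow> bool" and F :: "'e set set"
  assumes matroid: "matroid E indep" and F_eq: "F = containing_basis E indep"
begin

lemma finite_ground: "finite E"
  and indep_ground: "indep I \<Longrightarrow> I \<subseteq> E"
  and indep_empty: "indep {}"
  and indep_mono: "indep J \<Longrightarrow> I \<subseteq> J \<Longrightarrow> indep I"
  and indep_augment: "indep I \<Longrightarrow> indep J \<Longrightarrow> card I < card J \<Longrightarrow> \<exists>e\<in>J - I. indep (insert e I)"
  using matroid unfolding matroid_def by blast+

lemma finite_indep: "indep I \<Longrightarrow> finite I"
  using indep_ground finite_ground finite_subset by blast

lemma finite_subset_ground: "X \<subseteq> E \<Longrightarrow> finite X"
  using finite_ground finite_subset by blast

text \<open>These are the bases of the restriction to \<open>X\<close>. Maximality under adding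
  single elements is enough because independence is inherited by subsets.\<close>

definition basis_in :: "'e set \<Rightarrow> 'e set \<Rightarrow> bool" where
  "basis_in X I \<longleftrightarrow> I \<subseteq> X \<and> indep I \<and> (\<forall>e\<in>X - I. \<not> indep (insert e I))"

lemma extend_to_basis_in:
  assumes "indep I" "I \<subseteq> X" "X \<subseteq> E"
  obtains J where "I \<subseteq> J" "basis_in X J"
proof -
  have "finite {J. J \<subseteq> X \<and> indep J}"
    by (rule finite_subset[of _ "Pow E"]) (use assms finite_ground in auto)
  then obtain J where J: "J \<subseteq> X" "indep J" "I \<subseteq> J"
      "\<And>K. K \<subseteq> X \<Longrightarrow> indep K \<Longrightarrow> J \<subseteq> K \<Longrightarrow> J = K"
    using finite_has_maximal2[of "{J. J \<subseteq> X \<and> indep J}" I] assms by auto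
  have "\<not> indep (insert e J)" if "e \<in> X - J" for e
    using J(1) J(4)[of "insert e J"] that by blast
  then show thesis
    using that[of J] J unfolding basis_in_def by blast
qed

text \<open>A maximal independent \<open>J\<close> between \<open>I\<close> and
  \<open>I \<union> B\<close> cannot be smaller than \<open>B\<close>, since augmentation would add
  an element of \<open>B\<close> to it.\<close>

lemma extend_indep:
  assumes "indep I" "indep B"
  obtains J where "I \<subseteq> J" "J \<subseteq> I \<union> B" "indep J" "card B \<le> card J"
proof -
  obtain J where J: "I \<subseteq> J" "basis_in (I \<union> B) J"
    using extend_to_basis_in[of I "I \<union> B"] assms indep_ground by blast
  have "card B \<le> card J"
  proof (rule ccontr)
    assume "\<not> ?thesis"
    then obtain e where "e \<in> B - J" "indep (insert e J)"
      using indep_augment[of J B] J assms unfolding basis_in_def by auto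
    with J show False unfolding basis_in_def by blast
  qed
  with J that show thesis unfolding basis_in_def by blast
qed

lemma basis_of_iff: "basis_of indep B \<longleftrightarrow> basis_in E B"
proof
  assume "basis_of indep B"
  then show "basis_in E B"
    using indep_ground unfolding basis_of_def basis_in_def by blast
next
  assume B: "basis_in E B"
  have "X = B" if X: "indep X" "B \<subseteq> X" for X
  proof (rule ccontr)
    assume "X \<noteq> B"
    then obtain e where "e \<in> X" "e \<notin> B"
      using X by blast
    moreover have "indep (insert e B)"
      by (rule indep_mono[OF X(1)]) (use X calculation in blast)
    ultimately show False
      using B X indep_ground unfolding basis_in_def by blast
  qed
  with B show "basis_of indep B"
    unfolding basis_of_def basis_in_def by blast
qed

lemma card_le_basis:
  assumes "basis_in E B" "indep J"
  shows "card J \<le> card B"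
proof (rule ccontr)
  assume "\<not> ?thesis"
  then obtain e where "e \<in> J - B" "indep (insert e B)"
    using indep_augment[of B J] assms unfolding basis_in_def by auto
  with assms show False
    using indep_ground unfolding basis_in_def by blast
qed

lemma basis_if_card_ge:
  assumes "basis_in E B" "indep J" "card B \<le> card J"
  shows "basis_in E J"
proof -
  have "\<not> indep (insert e J)" if "e \<in> E - J" for e
    using card_le_basis[OF assms(1), of "insert e J"] assms(3) finite_indep[OF assms(2)] that
    by auto
  with assms(2) show ?thesis
    using indep_ground unfolding basis_in_def by blast
qed

lemma F_iff: "X \<in> F \<longleftrightarrow> X \<subseteq> E \<and> (\<exists>B. basis_in E B \<and> B \<subseteq> X)"
  unfolding F_eq containing_basis_def basis_of_iff by simp

lemma F_mono: "X \<in> F \<Longrightarrow> X \<subseteq> Y \<Longrightarrow> Y \<subseteq> E \<Longrightarrow> Y \<in> F"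
  unfolding F_iff by blast

lemma ground_in_F: "E \<in> F"
proof -
  obtain B where "basis_in E B"
    using extend_to_basis_in[OF indep_empty empty_subsetI order_refl] .
  then show ?thesis
    unfolding F_iff basis_in_def by auto
qed

text \<open>\<open>fresh X j\<close> says that \<open>j\<close> lies outside the closure of \<open>X\<close>.\<close>
definition fresh :: "'e set \<Rightarrow> 'e \<Rightarrow> bool" where
  "fresh X j \<longleftrightarrow> j \<notin> X \<and> (\<exists>I. basis_in X I \<and> indep (insert j I))"

lemma fresh_ground: "fresh X j \<Longrightarrow> j \<in> E"
  using indep_ground unfolding fresh_def by blast

lemma exists_fresh:
  assumes "X \<subseteq> E" "X \<notin> F"
  shows "\<exists>j. fresh X j"
proof -
  obtain I where I: "basis_in X I"
    using extend_to_basis_in[OF indep_empty empty_subsetI assms(1)] .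
  then have "\<not> basis_in E I"
    using assms unfolding F_iff basis_in_def by blast
  then obtain e where "e \<in> E - I" "indep (insert e I)"
    using I assms(1) unfolding basis_in_def by blast
  then show ?thesis
    using I unfolding fresh_def basis_in_def by blast
qed

text \<open>A basis \<open>I\<close> of \<open>X\<close> grows to a basis \<open>B1\<close> inside
  \<open>Z\<close>, and \<open>insert i I\<close> grows to a basis \<open>B2\<close> using elements
  of \<open>B1\<close>. If \<open>B2\<close> contained \<open>B1\<close>, then
  \<open>insert i B1\<close> would be independent, so \<open>B2\<close> misses some \<open>j\<close>
  in \<open>B1\<close>. Since \<open>insert j I\<close> is independent and \<open>I\<close> is
  maximal in \<open>X\<close>, this \<open>j\<close> is fresh, and \<open>B2\<close> is contained in
  \<open>insert i (Z - {j})\<close>.\<close>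

lemma fresh_exchange:
  assumes Z: "Z \<in> F" "X \<subseteq> Z" and i: "i \<notin> Z" "fresh X i"
  obtains j where "j \<in> Z - X" "fresh X j" "insert i (Z - {j}) \<in> F"
proof -
  obtain I where I: "basis_in X I" "indep (insert i I)"
    using i unfolding fresh_def by blast
  obtain B where B: "basis_in E B" "B \<subseteq> Z"
    using Z unfolding F_iff by blast
  have "indep I" "indep B" and ZE: "Z \<subseteq> E"
    using I B Z unfolding basis_in_def F_iff by auto
  obtain B1 where B1: "I \<subseteq> B1" "B1 \<subseteq> I \<union> B" "indep B1" "card B \<le> card B1"
    using extend_indep[OF \<open>indep I\<close> \<open>indep B\<close>] .
  moreover have "I \<union> B \<subseteq> Z"
    using I(1) B(2) Z(2) unfolding basis_in_def by blast
  moreover have "basis_in E B1"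
    using basis_if_card_ge[OF B(1) B1(3,4)] .
  ultimately have B1: "I \<subseteq> B1" "B1 \<subseteq> Z" "indep B1" "basis_in E B1"
    by auto
  obtain B2 where B2: "insert i I \<subseteq> B2" "B2 \<subseteq> insert i I \<union> B1" "indep B2" "card B1 \<le> card B2"
    using extend_indep[OF I(2) B1(3)] .
  have B2b: "basis_in E B2"
    by (rule basis_if_card_ge[OF B1(4)]) (fact B2)+
  have "\<not> B1 \<subseteq> B2"
  proof
    assume "B1 \<subseteq> B2"
    then have "insert i B1 \<subseteq> B2" using B2 by blast
    then have "indep (insert i B1)"
      using B2(3) indep_mono by blast
    then show False
      using B1 i(1) indep_ground[OF B2(3)] B2(1) unfolding basis_in_def by blast
  qed
  then obtain j where j: "j \<in> B1" "j \<notin> B2" by blast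
  have Ij: "indep (insert j I)"
    by (rule indep_mono[OF B1(3)]) (use j B1 in blast)
  have "j \<notin> I" using j B2 by blast
  then have "j \<notin> X"
    using I(1) Ij unfolding basis_in_def by blast
  have "fresh X j"
    using \<open>j \<notin> X\<close> I(1) Ij unfolding fresh_def by blast
  moreover have "insert i (Z - {j}) \<in> F"
    unfolding F_iff
    using B2b B2(2) j B1 ZE indep_ground[OF I(2)] by (intro conjI exI[of _ B2]) auto
  ultimately show thesis
    using that[of j] \<open>j \<notin> X\<close> j B1 by blast
qed

definition completion :: "'e set \<Rightarrow> ('e \<Rightarrow> real) \<Rightarrow> real" where
  "completion X w = Min (sum w ` {B. B \<subseteq> E - X \<and> X \<union> B \<in> F})"

lemma finite_completions: "finite {B. B \<subseteq> E - X \<and> P B}"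
  using finite_ground by (auto intro: finite_subset[of _ "Pow E"])

lemma completion_in_F:
  assumes "X \<in> F" "\<And>j. 0 \<le> w j"
  shows "completion X w = 0"
  unfolding completion_def
proof (rule Min_eqI)
  show "0 \<in> sum w ` {B. B \<subseteq> E - X \<and> X \<union> B \<in> F}"
    by (rule image_eqI[of _ _ "{}"]) (use assms in auto)
next
  show "finite (sum w ` {B. B \<subseteq> E - X \<and> X \<union> B \<in> F})"
    by (rule finite_imageI[OF finite_completions])
qed (use assms(2) in \<open>auto intro: sum_nonneg\<close>)

lemma completion_upd_accepted:
  assumes "i \<in> X"
  shows "completion X (w(i := x)) = completion X w"
proof -
  have "sum (w(i := x)) B = sum w B" if "B \<subseteq> E - X" for B
    using assms that by (intro sum.cong) auto
  then have "sum (w(i := x)) ` {B. B \<subseteq> E - X \<and> X \<union> B \<in> F} = sum w ` {B. B \<subseteq> E - X \<and> X \<union> B \<in> F}"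
    by (intro image_cong) auto
  then show ?thesis
    unfolding completion_def by simp
qed

text \<open>
  Since \<open>completion X\<close> is the smaller of an affine and a constant function of the weight of
  \<open>i\<close>, all that matters about a random weight of \<open>i\<close> is its truncated mean. The bound \<open>b\<close> makes
  up for the missing threshold when \<open>i\<close> is a coloop of the contraction by \<open>X\<close>.
\<close>
lemma completion_threshold:
  assumes X: "X \<subseteq> E" and i: "i \<in> E - X" and b: "0 \<le> b" and w: "\<And>j. 0 \<le> w j"
  obtains t where "0 \<le> t"
    "\<forall>x\<in>{0..b}. completion X (w(i := x)) = completion (insert i X) w + min x t"
    "\<forall>g\<le>b. fresh X i \<longrightarrow> (\<forall>j. fresh X j \<longrightarrow> j \<noteq> i \<longrightarrow> g \<le> w j) \<longrightarrow> g \<le> t"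
proof -
  \<comment> \<open>\<open>\<A>\<close> holds the completions that use \<open>i\<close>, with
    \<open>i\<close> removed, and \<open>\<C>\<close> those that avoid \<open>i\<close>. With minima
    \<open>a\<close> and \<open>c\<close>, weight \<open>x\<close> on \<open>i\<close> gives
    \<open>min (a + x) c\<close>, so the threshold is \<open>c - a\<close>.\<close>
  define \<A> where "\<A> = {B. B \<subseteq> E - insert i X \<and> insert i X \<union> B \<in> F}"
  define \<C> where "\<C> = {B. B \<subseteq> E - insert i X \<and> X \<union> B \<in> F}"
  define a where "a = Min (sum w ` \<A>)"
  have a: "completion (insert i X) w = a"
    unfolding a_def \<A>_def completion_def by simp
  have finA: "finite \<A>" and finC: "finite \<C>"
    unfolding \<A>_def \<C>_def by (rule finite_completions)+
  have "insert i X \<union> (E - insert i X) = E"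
    using X i by blast
  then have "E - insert i X \<in> \<A>"
    unfolding \<A>_def using ground_in_F by (intro CollectI conjI order_refl) (simp only:)
  then have A_ne: "\<A> \<noteq> {}" by blast
  have fin: "finite B" if "B \<subseteq> E" for B
    using that by (rule finite_subset_ground)
  have split: "{B. B \<subseteq> E - X \<and> X \<union> B \<in> F} = insert i ` \<A> \<union> \<C>" (is "?L = _")
  proof (intro set_eqI iffI)
    fix B assume B: "B \<in> ?L"
    show "B \<in> insert i ` \<A> \<union> \<C>"
    proof (cases "i \<in> B")
      case True
      then have eq: "B = insert i (B - {i})" by blast
      then have "X \<union> B = insert i X \<union> (B - {i})" by blast
      then have "B - {i} \<in> \<A>"
        using B unfolding \<A>_def by auto
      with eq show ?thesis by blast
    qed (use B in \<open>auto simp: \<C>_def\<close>)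
  next
    fix B assume "B \<in> insert i ` \<A> \<union> \<C>"
    then show "B \<in> ?L"
      using i unfolding \<A>_def \<C>_def by (auto simp: insert_commute)
  qed
  have sumA: "sum (w(i := x)) (insert i B) = sum w B + x" if "B \<in> \<A>" for x B
  proof -
    have "i \<notin> B" "finite B"
      using that fin unfolding \<A>_def by auto
    moreover have "sum (w(i := x)) B = sum w B"
      by (rule sum.cong) (use calculation in auto)
    ultimately show ?thesis by simp
  qed
  have sumC: "sum (w(i := x)) B = sum w B" if "B \<in> \<C>" for x B
    by (rule sum.cong) (use that in \<open>auto simp: \<C>_def\<close>)
  have imA: "Min (sum (w(i := x)) ` insert i ` \<A>) = a + x" for x
  proof -
    have "sum (w(i := x)) ` insert i ` \<A> = (\<lambda>B. sum w B + x) ` \<A>"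
      unfolding image_image by (rule image_cong) (use sumA in auto)
    then show ?thesis
      unfolding a_def using Min_add_commute[OF finA A_ne, of "sum w" x] by simp
  qed
  have imC: "sum (w(i := x)) ` \<C> = sum w ` \<C>" for x
    by (rule image_cong) (use sumC in auto)
  show thesis
  proof (cases "\<C> = {}")
    case True
    show thesis
    proof (rule that[of b]; (intro ballI)?)
      fix x assume "x \<in> {0..b}"
      then show "completion X (w(i := x)) = completion (insert i X) w + min x b"
        unfolding completion_def[of X] split True Un_empty_right imA a by simp
    qed (use b in auto)
  next
    case False
    define c where "c = Min (sum w ` \<C>)"
    have "c \<in> sum w ` \<C>"
      unfolding c_def by (rule Min_in) (use False finC in auto)
    then obtain B where B: "B \<in> \<C>" "c = sum w B" by blast
    have a_le: "a \<le> sum w B'" if "B' \<in> \<A>" for B'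
      unfolding a_def by (rule Min_le) (use that finA in auto)
    \<comment> \<open>A completion that avoids \<open>i\<close> remains one when \<open>i\<close> is
      added for free, hence \<open>a \<le> c\<close> and the threshold is nonnegative.\<close>
    have "insert i (X \<union> B) \<in> F"
      using B(1) i X F_mono[of "X \<union> B" "insert i (X \<union> B)"] unfolding \<C>_def by blast
    then have "B \<in> \<A>"
      using B(1) unfolding \<A>_def \<C>_def by simp
    then have ac: "a \<le> c"
      using a_le B(2) by simp
    show thesis
    proof (rule that[of "c - a"]; (intro ballI allI impI)?)
      show "0 \<le> c - a" using ac by simp
    next
      fix x :: real assume "x \<in> {0..b}"
      have "completion X (w(i := x)) =
          min (Min (sum (w(i := x)) ` insert i ` \<A>)) (Min (sum (w(i := x)) ` \<C>))"
        unfolding completion_def split image_Un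
        by (rule Min_Un) (use finA finC A_ne False in auto)
      then have "completion X (w(i := x)) = min (a + x) c"
        unfolding imA imC c_def .
      then show "completion X (w(i := x)) = completion (insert i X) w + min x (c - a)"
        unfolding a by (simp add: min_def)
    next
      \<comment> \<open>In the cheapest completion \<open>B\<close> avoiding \<open>i\<close>,
        exchange some fresh \<open>j\<close> for \<open>i\<close>. The remainder
        \<open>B - {j}\<close> lies in \<open>\<A>\<close>, so
        \<open>a \<le> c - w j \<le> c - g\<close>.\<close>
      fix g assume g: "fresh X i" "\<forall>j. fresh X j \<longrightarrow> j \<noteq> i \<longrightarrow> g \<le> w j"
      have "X \<union> B \<in> F" "i \<notin> X \<union> B" and BE: "B \<subseteq> E" and BX: "B \<inter> X = {}"
        using B(1) i unfolding \<C>_def by auto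
      then obtain j where j: "j \<in> B" "fresh X j" "insert i ((X \<union> B) - {j}) \<in> F"
        using fresh_exchange[of "X \<union> B" X i] g(1) by blast
      have "insert i ((X \<union> B) - {j}) = insert i X \<union> (B - {j})"
        using j(1) BX by blast
      then have "B - {j} \<in> \<A>"
        using j(3) B(1) unfolding \<A>_def \<C>_def by auto
      then have "a \<le> sum w (B - {j})"
        by (rule a_le)
      then have "a \<le> sum w B - w j"
        using j(1) fin[OF BE] by (simp add: sum_diff1)
      moreover have "g \<le> w j"
        using g(2) j(1,2) B(1) unfolding \<C>_def by blast
      ultimately show "g \<le> c - a"
        using B(2) by simp
    qed
  qed
qed

section \<open>Expected completions for independent random weights\<close>

definition expected_completion :: "('e \<Rightarrow> real pmf) \<Rightarrow> 'e set \<Rightarrow> real" where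
  "expected_completion W X = measure_pmf.expectation (Pi_pmf E 0 W) (completion X)"

text \<open>The default \<open>0\<close> outside \<open>A\<close> makes a sampled weight function
  nonnegative at every index, the form in which \<open>completion_threshold\<close> asks for
  it.\<close>

lemma Pi_pmf_nonneg:
  fixes W :: "'e \<Rightarrow> real pmf"
  assumes "A \<subseteq> E" "\<And>j. j \<in> A \<Longrightarrow> set_pmf (W j) \<subseteq> {0..}" "w \<in> set_pmf (Pi_pmf A 0 W)"
  shows "0 \<le> w j"
proof -
  have "finite A" using assms(1) finite_subset_ground by blast
  then have "w \<in> PiE_dflt A 0 (set_pmf \<circ> W)"
    using assms(3) set_Pi_pmf[of A 0 W] by simp
  then show ?thesis
    using assms(2) unfolding PiE_dflt_def by (cases "j \<in> A") auto
qed

lemma grid_bound: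
  fixes Y :: "real set"
  assumes "finite Y" "Y \<subseteq> {0..}"
  obtains b where "0 \<le> b" "Y \<subseteq> {0..b}"
proof -
  obtain b where "\<forall>y\<in>Y. y \<le> b"
    using bdd_above_finite[OF assms(1)] unfolding bdd_above_def by blast
  then show thesis
    using that[of "max 0 b"] assms(2) by force
qed

lemma Pi_pmf_upd_outside: "Pi_pmf (E - {i}) d (W(i := U)) = Pi_pmf (E - {i}) d W"
  by (rule Pi_pmf_cong) simp_all

text \<open>
  \<open>T\<close> is the law of the threshold of \<open>completion_threshold\<close> when all weights but that of \<open>i\<close> are
  drawn from \<open>W\<close>.
\<close>
lemma expected_completion_threshold:
  assumes X: "X \<subseteq> E" and i: "i \<in> E - X" and Y: "finite Y" "Y \<subseteq> {0..}"
    and W: "\<And>j. j \<in> E \<Longrightarrow> set_pmf (W j) \<subseteq> Y"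
  obtains T where "finite (set_pmf T)" "set_pmf T \<subseteq> {0..}"
    "\<forall>g\<in>Y. fresh X i \<longrightarrow> (\<forall>j. fresh X j \<longrightarrow> j \<noteq> i \<longrightarrow> set_pmf (W j) \<subseteq> {g..}) \<longrightarrow> set_pmf T \<subseteq> {g..}"
    "\<forall>U. set_pmf U \<subseteq> Y \<longrightarrow> expected_completion (W(i := U)) X =
      expected_completion W (insert i X) + measure_pmf.expectation T (capped_mean U)"
proof -
  obtain b where b: "0 \<le> b" "Y \<subseteq> {0..b}"
    using grid_bound[OF Y] .
  define good where "good w t \<longleftrightarrow> 0 \<le> t \<and>
      (\<forall>x\<in>{0..b}. completion X (w(i := x)) = completion (insert i X) w + min x t) \<and>
      (\<forall>g\<le>b. fresh X i \<longrightarrow> (\<forall>j. fresh X j \<longrightarrow> j \<noteq> i \<longrightarrow> g \<le> w j) \<longrightarrow> g \<le> t)"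
    for w t
  have "\<exists>t. (\<forall>j. 0 \<le> w j) \<longrightarrow> good w t" for w
  proof (cases "\<forall>j. 0 \<le> w j")
    case True
    then have w: "\<And>j. 0 \<le> w j" by simp
    show ?thesis
      using completion_threshold[of X i b w, OF X i b(1) w] unfolding good_def by metis
  qed blast
  then obtain t where t: "\<forall>w. (\<forall>j. 0 \<le> w j) \<longrightarrow> good w (t w)"
    by metis
  \<comment> \<open>\<open>R\<close> draws all weights except that of \<open>i\<close>, whose
    coordinate is overwritten afterwards. The threshold \<open>t w\<close> therefore does not depend
    on the law \<open>U\<close> put in that coordinate.\<close>
  define R where "R = Pi_pmf (E - {i}) 0 W"
  have fin: "finite (set_pmf (W j))" if "j \<in> E" for j
    using W[OF that] Y(1) finite_subset by blast
  have finR: "finite (set_pmf R)"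
    unfolding R_def by (rule finite_set_Pi_pmf) (use finite_ground fin in auto)
  have R_nonneg: "0 \<le> w j" if "w \<in> set_pmf R" for w j
    using that W Y unfolding R_def by (intro Pi_pmf_nonneg[of "E - {i}" W w j]) auto
  then have good: "good w (t w)" if "w \<in> set_pmf R" for w
    using t that by blast
  have split: "measure_pmf.expectation (Pi_pmf E 0 (W(i := U))) h =
      measure_pmf.expectation R (\<lambda>w. measure_pmf.expectation U (\<lambda>x. h (w(i := x))))"
    if "finite (set_pmf U)" for U and h :: "('e \<Rightarrow> real) \<Rightarrow> real"
  proof -
    have finU: "finite (set_pmf ((W(i := U)) j))" if "j \<in> E" for j
      using fin that \<open>finite (set_pmf U)\<close> by simp
    have "i \<in> E" using i by simp
    from expectation_Pi_pmf_split[where W = "W(i := U)" and d = 0 and h = h, OF finite_ground this finU] show ?thesis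
      unfolding R_def Pi_pmf_upd_outside by simp
  qed
  show thesis
  proof (rule that[of "map_pmf t R"])
    show "finite (set_pmf (map_pmf t R))"
      using finR by simp
    show "set_pmf (map_pmf t R) \<subseteq> {0..}"
      using good by (auto simp: good_def)
    show "\<forall>g\<in>Y. fresh X i \<longrightarrow> (\<forall>j. fresh X j \<longrightarrow> j \<noteq> i \<longrightarrow> set_pmf (W j) \<subseteq> {g..}) \<longrightarrow>
      set_pmf (map_pmf t R) \<subseteq> {g..}"
    proof (intro ballI impI)
      fix g assume g: "g \<in> Y" "fresh X i"
        "\<forall>j. fresh X j \<longrightarrow> j \<noteq> i \<longrightarrow> set_pmf (W j) \<subseteq> {g..}"
      have "g \<le> t w" if w: "w \<in> set_pmf R" for w
      proof -
        have "w \<in> PiE_dflt (E - {i}) 0 (set_pmf \<circ> W)"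
          using w set_Pi_pmf[of "E - {i}" 0 W] finite_ground unfolding R_def by simp
        then have "w j \<in> set_pmf (W j)" if "j \<in> E" "j \<noteq> i" for j
          using that unfolding PiE_dflt_def by auto
        then have "\<forall>j. fresh X j \<longrightarrow> j \<noteq> i \<longrightarrow> g \<le> w j"
          using g(3) fresh_ground by fastforce
        moreover have "g \<le> b"
          using g(1) b(2) by auto
        ultimately show ?thesis
          using good[OF w] g(2) unfolding good_def by blast
      qed
      then show "set_pmf (map_pmf t R) \<subseteq> {g..}" by auto
    qed
    show "\<forall>U. set_pmf U \<subseteq> Y \<longrightarrow> expected_completion (W(i := U)) X =
      expected_completion W (insert i X) + measure_pmf.expectation (map_pmf t R) (capped_mean U)"
    proof (intro allI impI)
      fix U assume U: "set_pmf U \<subseteq> Y"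
      then have finU: "finite (set_pmf U)"
        using Y(1) finite_subset by blast
      have "expected_completion (W(i := U)) X = measure_pmf.expectation R
          (\<lambda>w. completion (insert i X) w + capped_mean U (t w))"
        unfolding expected_completion_def split[OF finU]
      proof (rule expectation_cong)
        fix w assume w: "w \<in> set_pmf R"
        have "measure_pmf.expectation U (\<lambda>x. completion X (w(i := x))) =
            measure_pmf.expectation U (\<lambda>x. completion (insert i X) w + min x (t w))"
        proof (rule expectation_cong)
          fix x assume "x \<in> set_pmf U"
          then have "x \<in> {0..b}"
            using U b by blast
          then show "completion X (w(i := x)) = completion (insert i X) w + min x (t w)"
            using good[OF w] unfolding good_def by blast
        qed
        then show "measure_pmf.expectation U (\<lambda>x. completion X (w(i := x))) =
            completion (insert i X) w + capped_mean U (t w)"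
          by (simp add: expectation_add[OF finU] capped_mean_def)
      qed
      moreover have "expected_completion W (insert i X) =
          measure_pmf.expectation R (completion (insert i X))"
        using split[of "W i" "completion (insert i X)"] fin i unfolding expected_completion_def
        by (simp add: completion_upd_accepted)
      ultimately show "expected_completion (W(i := U)) X = expected_completion W (insert i X) +
          measure_pmf.expectation (map_pmf t R) (capped_mean U)"
        by (simp add: expectation_add[OF finR])
    qed
  qed
qed

lemma expected_completion_in_F:
  assumes "X \<in> F" "\<And>j. j \<in> E \<Longrightarrow> set_pmf (W j) \<subseteq> {0..}"
  shows "expected_completion W X = 0"
proof -
  have "expected_completion W X = measure_pmf.expectation (Pi_pmf E 0 W) (\<lambda>_. 0)"
    unfolding expected_completion_def
    by (rule expectation_cong) (use Pi_pmf_nonneg[of E W] assms completion_in_F in auto)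
  then show ?thesis by simp
qed

text \<open>The laws are exchanged one at a time through the hybrids \<open>mix S\<close>. With the
  other laws fixed, the expected completion is a constant plus an average of truncated means over
  nonnegative thresholds, so comparing truncated means suffices.\<close>

lemma expected_completion_mono:
  assumes Y: "finite Y" "Y \<subseteq> {0..}"
    and U: "\<And>j. j \<in> E \<Longrightarrow> set_pmf (U j) \<subseteq> Y" and W: "\<And>j. j \<in> E \<Longrightarrow> set_pmf (W j) \<subseteq> Y"
    and le: "\<And>j t. j \<in> E \<Longrightarrow> 0 \<le> t \<Longrightarrow> capped_mean (U j) t \<le> capped_mean (W j) t"
  shows "expected_completion U {} \<le> expected_completion W {}"
proof -
  define mix where "mix S j = (if j \<in> S then U j else W j)" for S j
  have "expected_completion (mix S) {} \<le> expected_completion W {}" if "finite S" "S \<subseteq> E" for S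
    using that
  proof (induction S rule: finite_induct)
    case empty
    then show ?case by (simp add: mix_def)
  next
    case (insert i S)
    have mix: "mix (insert i S) = (mix S)(i := U i)" "mix S = (mix S)(i := W i)"
      using insert.hyps by (auto simp: mix_def fun_eq_iff)
    have supp: "set_pmf (mix S j) \<subseteq> Y" if "j \<in> E" for j
      using U W that by (auto simp: mix_def)
    have i: "i \<in> E - {}" using insert.prems by simp
    obtain T where T: "finite (set_pmf T)" "set_pmf T \<subseteq> {0..}"
      and "\<forall>g\<in>Y. fresh {} i \<longrightarrow> (\<forall>j. fresh {} j \<longrightarrow> j \<noteq> i \<longrightarrow> set_pmf (mix S j) \<subseteq> {g..}) \<longrightarrow>
        set_pmf T \<subseteq> {g..}"
      and eq: "\<forall>V. set_pmf V \<subseteq> Y \<longrightarrow> expected_completion ((mix S)(i := V)) {} =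
        expected_completion (mix S) {i} + measure_pmf.expectation T (capped_mean V)"
      using expected_completion_threshold[OF empty_subsetI i Y supp] .
    have "measure_pmf.expectation T (capped_mean (U i)) \<le>
        measure_pmf.expectation T (capped_mean (W i))"
      using T(2) le i by (intro expectation_mono[OF T(1)]) auto
    then have "expected_completion ((mix S)(i := U i)) {} \<le> expected_completion ((mix S)(i := W i)) {}"
      using eq U W i by simp
    also have "\<dots> \<le> expected_completion W {}"
      using insert.IH insert.prems mix(2) by simp
    finally show ?case
      unfolding mix(1) .
  qed
  from this[OF finite_ground order_refl] have "expected_completion (mix E) {} \<le> expected_completion W {}" .
  moreover have "Pi_pmf E 0 (mix E) = Pi_pmf E 0 U"
    by (rule Pi_pmf_cong) (auto simp: mix_def)
  ultimately show ?thesis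
    unfolding expected_completion_def by simp
qed

end

section \<open>Policies and the index rule\<close>

text \<open>The nonnegative variable \<open>k - min w k\<close> has mean zero and so vanishes on the
  support. Applied at a Gittins index, which is a fixed point of the curve, this puts the surrogate
  weight at or above the index.\<close>

lemma set_pmf_ge_if_capped_mean:
  assumes "finite (set_pmf W)" "capped_mean W k = k"
  shows "set_pmf W \<subseteq> {k..}"
proof -
  have int: "integrable (measure_pmf W) f" for f :: "real \<Rightarrow> real"
    using assms(1) by (rule integrable_measure_pmf_finite)
  have "measure_pmf.expectation W (\<lambda>w. k - min w k) = 0"
    using assms(2) by (simp add: Bochner_Integration.integral_diff[OF int int] capped_mean_def)
  then have "AE w in measure_pmf W. k - min w k = 0"
    using integral_nonneg_eq_0_iff_AE[OF int, of "\<lambda>w. k - min w k"] by simp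
  then show ?thesis
    by (auto simp: AE_measure_pmf_iff min_def split: if_splits)
qed

text \<open>This is \<open>capped_mean_mixture\<close> with a single successor of weight zero, whose
  truncated means at nonnegative points vanish. It serves the terminal states.\<close>

lemma capped_mean_le_on_grid:
  assumes Y: "finite Y" "0 \<in> Y" "\<And>y. y \<in> Y \<Longrightarrow> 0 \<le> y"
    and W: "set_pmf W \<subseteq> Y" and k: "k \<in> Y" "k \<le> t"
    and grid: "\<And>y. y \<in> Y \<Longrightarrow> k \<le> y \<Longrightarrow> r * capped_mean W y \<le> r * b"
  shows "r * capped_mean W t \<le> r * b"
proof -
  have zero: "capped_mean (return_pmf 0) y = 0" if "0 \<le> y" for y
    using that by (simp add: capped_mean_def)
  have "r * capped_mean W t \<le> r * b + r * measure_pmf.expectation (return_pmf ())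
      (\<lambda>_. capped_mean (return_pmf 0) t)"
    by (rule capped_mean_mixture[OF Y(1) k W]) (use grid Y zero in auto)
  moreover have "0 \<le> t"
    using Y(3)[OF k(1)] k(2) by simp
  ultimately show ?thesis
    using zero by simp
qed

definition (in finite_mdp) height :: "'s \<Rightarrow> nat" where
  "height s = card ((transition_graph M)\<^sup>+ `` {s})"

text \<open>Everything reachable from \<open>s'\<close> is reachable from \<open>s\<close>, while
  \<open>s'\<close> itself is reachable from \<open>s\<close> but, by acyclicity, not from
  \<open>s'\<close>.\<close>

lemma (in finite_mdp) height_less:
  assumes "s \<in> nonterm M" "a \<in> macts M s" "s' \<in> set_pmf (mtrans M s a)"
  shows "height s' < height s"
  unfolding height_def
proof (rule psubset_card_mono)
  have edge: "(s, s') \<in> transition_graph M"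
    using assms unfolding transition_graph_def by blast
  have "finite ((transition_graph M)\<^sup>+)"
    using finite_transition_graph by simp
  then show "finite ((transition_graph M)\<^sup>+ `` {s})"
    by (rule finite_Image)
  have "(s', s') \<notin> (transition_graph M)\<^sup>+"
    using acyclic_transitions unfolding acyclic_def by blast
  moreover have "(transition_graph M)\<^sup>+ `` {s'} \<subseteq> (transition_graph M)\<^sup>+ `` {s}"
    using edge by (auto intro: trancl_into_trancl2)
  moreover have "s' \<in> (transition_graph M)\<^sup>+ `` {s}"
    using edge by auto
  ultimately show "(transition_graph M)\<^sup>+ `` {s'} \<subset> (transition_graph M)\<^sup>+ `` {s}"
    by blast
qed

locale cics = matroid_family "{1..n}" indep F
  for n :: nat and indep :: "nat set \<Rightarrow> bool" and F :: "nat set set" +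
  fixes M :: "nat \<Rightarrow> ('s, 'a) ci_mdp"
  assumes mdps: "\<And>i. i \<in> {1..n} \<Longrightarrow> finite_mdp (M i)"
begin

abbreviation proper_states :: "(nat \<Rightarrow> 's) \<Rightarrow> bool" where
  "proper_states q \<equiv> \<forall>i\<in>{1..n}. q i \<in> mstates (M i)"

lemma proper_start: "proper_states (\<lambda>i. mstart (M i))"
  using mdps finite_mdp.start_state by blast

lemma proper_upd:
  assumes "proper_states q" "i \<in> {1..n}" "q i \<in> nonterm (M i)" "a \<in> macts (M i) (q i)"
    "s \<in> set_pmf (mtrans (M i) (q i) a)"
  shows "proper_states (q(i := s))"
  using assms finite_mdp.trans_states[OF mdps[OF assms(2)] assms(3,4)] by auto

lemma finite_trans:
  assumes "i \<in> {1..n}" "s \<in> nonterm (M i)" "a \<in> macts (M i) s"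
  shows "finite (set_pmf (mtrans (M i) s a))"
  by (rule finite_mdp.finite_trans[OF mdps]) fact+

lemma policy_cost_nonneg:
  assumes "valid_policy n M F P q X"
  shows "0 \<le> policy_cost M P q"
  using assms
proof (induction P arbitrary: q X)
  case (Accept i P)
  then have "0 \<le> mean_val (M i) (q i)"
    by (intro finite_mdp.val_nonneg[OF mdps]) auto
  with Accept show ?case by auto
next
  case (Advance i a P)
  then have "0 \<le> mcost (M i) a"
    by (intro finite_mdp.cost_nonneg[OF mdps]) auto
  moreover have "0 \<le> measure_pmf.expectation (mtrans (M i) (q i) a)
      (\<lambda>s. policy_cost M (P s) (q(i := s)))"
  proof (rule expectation_nonneg)
    fix s assume "s \<in> set_pmf (mtrans (M i) (q i) a)"
    then have "valid_policy n M F (P s) (q(i := s)) X"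
      using Advance.prems by simp
    then show "0 \<le> policy_cost M (P s) (q(i := s))"
      by (rule Advance.IH[OF rangeI])
  qed
  ultimately show ?case by simp
qed auto

lemma OPT_le:
  assumes "valid_policy n M F P (\<lambda>i. mstart (M i)) {}"
  shows "OPT n M F \<le> policy_cost M P (\<lambda>i. mstart (M i))"
  unfolding OPT_def
  by (rule cINF_lower) (use assms policy_cost_nonneg in \<open>auto intro!: bdd_belowI2[of _ 0]\<close>)

text \<open>Along any policy, the potential plus \<open>r\<close> times the cost paid never
  decreases in expectation, and the potential is \<open>0\<close> on stopping. A move at
  \<open>i\<close> affects only the truncated means of \<open>i\<close> averaged over random
  thresholds, and \<open>accept\<close> and \<open>advance\<close> hold at every nonnegative
  threshold.\<close>

lemma policy_lower_bound:
  assumes Y: "finite Y" "Y \<subseteq> {0..}"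
    and V: "\<And>i s. i \<in> {1..n} \<Longrightarrow> set_pmf (V i s) \<subseteq> Y"
    and accept: "\<And>i s t. i \<in> {1..n} \<Longrightarrow> s \<in> mterm (M i) \<Longrightarrow> 0 \<le> t \<Longrightarrow>
      capped_mean (V i s) t \<le> r * mean_val (M i) s"
    and advance: "\<And>i s a t. i \<in> {1..n} \<Longrightarrow> s \<in> nonterm (M i) \<Longrightarrow> a \<in> macts (M i) s \<Longrightarrow> 0 \<le> t \<Longrightarrow>
      capped_mean (V i s) t \<le> r * mcost (M i) a +
        measure_pmf.expectation (mtrans (M i) s a) (\<lambda>s'. capped_mean (V i s') t)"
    and "valid_policy n M F P q X" "X \<subseteq> {1..n}" "proper_states q"
  shows "expected_completion (\<lambda>i. V i (q i)) X \<le> r * policy_cost M P q"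
  using assms(6-)
proof (induction P arbitrary: q X)
  case Stop
  have V_nonneg: "set_pmf (V i s) \<subseteq> {0..}" if "i \<in> {1..n}" for i s
    using V[OF that] Y(2) by blast
  have "expected_completion (\<lambda>i. V i (q i)) X = 0"
    by (intro expected_completion_in_F V_nonneg) (use Stop in auto)
  then show ?case by simp
next
  case (Accept i P)
  define W where "W = (\<lambda>j. V j (q j))"
  have i: "i \<in> {1..n} - X" and i': "i \<in> {1..n}"
    using Accept.prems by auto
  have W: "\<And>j. j \<in> {1..n} \<Longrightarrow> set_pmf (W j) \<subseteq> Y"
    using V unfolding W_def by blast
  obtain T where T: "finite (set_pmf T)" "set_pmf T \<subseteq> {0..}"
    and "\<forall>g\<in>Y. fresh X i \<longrightarrow> (\<forall>j. fresh X j \<longrightarrow> j \<noteq> i \<longrightarrow> set_pmf (W j) \<subseteq> {g..}) \<longrightarrow> set_pmf T \<subseteq> {g..}"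
    and eq: "\<forall>U. set_pmf U \<subseteq> Y \<longrightarrow> expected_completion (W(i := U)) X =
      expected_completion W (insert i X) + measure_pmf.expectation T (capped_mean U)"
    using expected_completion_threshold[OF Accept.prems(2) i Y W] .
  have "measure_pmf.expectation T (capped_mean (W i)) \<le>
      measure_pmf.expectation T (\<lambda>_. r * mean_val (M i) (q i))"
    by (rule expectation_mono[OF T(1)]) (use accept[OF i'] Accept.prems T(2) in \<open>auto simp: W_def\<close>)
  moreover have "expected_completion W X =
      expected_completion W (insert i X) + measure_pmf.expectation T (capped_mean (W i))"
    using eq[rule_format, OF W[OF i']] by simp
  moreover have "expected_completion W (insert i X) \<le> r * policy_cost M P q"
    unfolding W_def by (rule Accept.IH) (use Accept.prems in auto)
  ultimately show ?case
    unfolding W_def by (simp add: distrib_left)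
next
  case (Advance i a P)
  define W where "W = (\<lambda>j. V j (q j))"
  let ?p = "mtrans (M i) (q i) a"
  have i: "i \<in> {1..n} - X" and i': "i \<in> {1..n}" and s: "q i \<in> nonterm (M i)" "a \<in> macts (M i) (q i)"
    using Advance.prems by auto
  have W: "\<And>j. j \<in> {1..n} \<Longrightarrow> set_pmf (W j) \<subseteq> Y"
    using V unfolding W_def by blast
  obtain T where T: "finite (set_pmf T)" "set_pmf T \<subseteq> {0..}"
    and "\<forall>g\<in>Y. fresh X i \<longrightarrow> (\<forall>j. fresh X j \<longrightarrow> j \<noteq> i \<longrightarrow> set_pmf (W j) \<subseteq> {g..}) \<longrightarrow> set_pmf T \<subseteq> {g..}"
    and eq: "\<forall>U. set_pmf U \<subseteq> Y \<longrightarrow> expected_completion (W(i := U)) X =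
      expected_completion W (insert i X) + measure_pmf.expectation T (capped_mean U)"
    using expected_completion_threshold[OF Advance.prems(2) i Y W] .
  note fin = finite_trans[OF i' s]
  have W_upd: "(\<lambda>j. V j ((q(i := s)) j)) = W(i := V i s)" for s
    unfolding W_def by auto
  have "expected_completion W X =
      expected_completion W (insert i X) + measure_pmf.expectation T (capped_mean (W i))"
    using eq[rule_format, OF W[OF i']] by simp
  also have "\<dots> \<le> expected_completion W (insert i X) + measure_pmf.expectation T
      (\<lambda>t. r * mcost (M i) a + measure_pmf.expectation ?p (\<lambda>s'. capped_mean (V i s') t))"
    by (intro add_left_mono expectation_mono[OF T(1)])
      (use advance[OF i' s] T(2) in \<open>auto simp: W_def\<close>)
  \<comment> \<open>The law \<open>T\<close> of the threshold does not involve the state of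
    \<open>i\<close>, so the averages over thresholds and over successors may be
    interchanged.\<close>
  also have "\<dots> = r * mcost (M i) a + measure_pmf.expectation ?p (\<lambda>s'.
      expected_completion W (insert i X) + measure_pmf.expectation T (capped_mean (V i s')))"
    using expectation_swap[OF T(1) fin, of "\<lambda>t s'. capped_mean (V i s') t"]
    by (simp add: expectation_add[OF T(1)] expectation_add[OF fin])
  also have "\<dots> \<le> r * mcost (M i) a +
      measure_pmf.expectation ?p (\<lambda>s'. r * policy_cost M (P s') (q(i := s')))"
  proof (intro add_left_mono expectation_mono[OF fin])
    fix s' assume s': "s' \<in> set_pmf ?p"
    then have "valid_policy n M F (P s') (q(i := s')) X"
      using Advance.prems(1) by simp
    then have "expected_completion (\<lambda>j. V j ((q(i := s')) j)) X \<le> r * policy_cost M (P s') (q(i := s'))"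
      by (rule Advance.IH[OF rangeI]) (rule Advance.prems(2) proper_upd[OF Advance.prems(3) i' s s'])+
    then show "expected_completion W (insert i X) + measure_pmf.expectation T (capped_mean (V i s'))
        \<le> r * policy_cost M (P s') (q(i := s'))"
      unfolding W_upd using eq V[OF i'] by simp
  qed
  also have "\<dots> = r * policy_cost M (Advance i a P) q"
    by (simp add: distrib_left)
  finally show ?case
    unfolding W_def .
next
  case (Toss p P Q)
  define e where "e = expected_completion (\<lambda>i. V i (q i)) X"
  have "e \<le> r * policy_cost M P q" "e \<le> r * policy_cost M Q q" and p: "0 \<le> p" "p \<le> 1"
    unfolding e_def using Toss by auto
  then have "p * e + (1 - p) * e \<le> p * (r * policy_cost M P q) + (1 - p) * (r * policy_cost M Q q)"
    by (intro add_mono mult_left_mono) auto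
  then show ?case
    unfolding e_def[symmetric] by (simp add: algebra_simps)
qed

section \<open>Policies obtained from a decreasing potential\<close>

definition remaining :: "(nat \<Rightarrow> 's) \<Rightarrow> nat set \<Rightarrow> nat" where
  "remaining q X = (\<Sum>i\<in>{1..n}. finite_mdp.height (M i) (q i)) + card ({1..n} - X)"

lemma remaining_accept:
  assumes "i \<in> {1..n} - X"
  shows "remaining q (insert i X) < remaining q X"
proof -
  have "card ({1..n} - insert i X) < card ({1..n} - X)"
    by (subst Diff_insert, rule card_Diff1_less) (use assms in simp_all)
  then show ?thesis unfolding remaining_def by simp
qed

lemma remaining_advance:
  assumes i: "i \<in> {1..n}" and s: "q i \<in> nonterm (M i)" "a \<in> macts (M i) (q i)"
    "s \<in> set_pmf (mtrans (M i) (q i) a)"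
  shows "remaining (q(i := s)) X < remaining q X"
proof -
  have "(\<Sum>j\<in>{1..n}. finite_mdp.height (M j) ((q(i := s)) j)) <
      (\<Sum>j\<in>{1..n}. finite_mdp.height (M j) (q j))"
    by (rule sum_strict_mono_ex1)
      (use i finite_mdp.height_less[OF mdps[OF i] s] in \<open>auto intro: less_imp_le\<close>)
  then show ?thesis unfolding remaining_def by simp
qed

text \<open>Follow at every node a move supplied by \<open>move\<close>: cost paid plus potential
  does not increase in expectation, and the potential is nonnegative at the end. An advance lowers
  one height and an acceptance shrinks the unaccepted set, so \<open>remaining\<close> drops and the
  recursion yields a finite decision tree.\<close>

lemma policy_of_decreasing_potential:
  assumes nonneg: "\<And>q X. proper_states q \<Longrightarrow> X \<in> F \<Longrightarrow> 0 \<le> H q X"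
    and move: "\<And>q X. proper_states q \<Longrightarrow> X \<subseteq> {1..n} \<Longrightarrow> X \<notin> F \<Longrightarrow> \<exists>i\<in>{1..n} - X.
      q i \<in> mterm (M i) \<and> mean_val (M i) (q i) + H q (insert i X) \<le> H q X \<or>
      q i \<in> nonterm (M i) \<and> (\<exists>a\<in>macts (M i) (q i). mcost (M i) a +
        measure_pmf.expectation (mtrans (M i) (q i) a) (\<lambda>s. H (q(i := s)) X) \<le> H q X)"
    and "proper_states q" "X \<subseteq> {1..n}"
  shows "\<exists>P. valid_policy n M F P q X \<and> policy_cost M P q \<le> H q X"
  using assms(3,4)
proof (induction "remaining q X" arbitrary: q X rule: less_induct)
  case less
  show ?case
  proof (cases "X \<in> F")
    case True
    then show ?thesis
      using nonneg less.prems by (intro exI[of _ Stop]) auto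
  next
    case False
    with move[OF less.prems] obtain i where i: "i \<in> {1..n} - X" and
      cases: "q i \<in> mterm (M i) \<and> mean_val (M i) (q i) + H q (insert i X) \<le> H q X \<or>
      q i \<in> nonterm (M i) \<and> (\<exists>a\<in>macts (M i) (q i). mcost (M i) a +
        measure_pmf.expectation (mtrans (M i) (q i) a) (\<lambda>s. H (q(i := s)) X) \<le> H q X)"
      by blast
    have i': "i \<in> {1..n}" using i by simp
    from cases show ?thesis
    proof
      assume t: "q i \<in> mterm (M i) \<and> mean_val (M i) (q i) + H q (insert i X) \<le> H q X"
      obtain P where "valid_policy n M F P q (insert i X)" "policy_cost M P q \<le> H q (insert i X)"
        using less.hyps[OF remaining_accept[OF i]] less.prems i by blast
      then show ?thesis
        using t i False by (intro exI[of _ "Accept i P"]) auto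
    next
      assume "q i \<in> nonterm (M i) \<and> (\<exists>a\<in>macts (M i) (q i). mcost (M i) a +
        measure_pmf.expectation (mtrans (M i) (q i) a) (\<lambda>s. H (q(i := s)) X) \<le> H q X)"
      then obtain a where s: "q i \<in> nonterm (M i)" "a \<in> macts (M i) (q i)"
        and le: "mcost (M i) a + measure_pmf.expectation (mtrans (M i) (q i) a)
          (\<lambda>s. H (q(i := s)) X) \<le> H q X"
        by blast
      have "\<exists>P. valid_policy n M F P (q(i := s')) X \<and> policy_cost M P (q(i := s')) \<le> H (q(i := s')) X"
        if "s' \<in> set_pmf (mtrans (M i) (q i) a)" for s'
        using less.hyps[OF remaining_advance[of i q a s' X, OF i' s that]
            proper_upd[of q i a s', OF less.prems(1) i' s that] less.prems(2)] .
      then obtain P where P: "\<And>s'. s' \<in> set_pmf (mtrans (M i) (q i) a) \<Longrightarrow>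
          valid_policy n M F (P s') (q(i := s')) X \<and> policy_cost M (P s') (q(i := s')) \<le> H (q(i := s')) X"
        by metis
      have "measure_pmf.expectation (mtrans (M i) (q i) a) (\<lambda>s'. policy_cost M (P s') (q(i := s'))) \<le>
          measure_pmf.expectation (mtrans (M i) (q i) a) (\<lambda>s'. H (q(i := s')) X)"
        by (rule expectation_mono[OF finite_trans[OF i' s]]) (use P in blast)
      with le have "policy_cost M (Advance i a P) q \<le> H q X"
        by simp
      moreover have "valid_policy n M F (Advance i a P) q X"
        using P s i False by simp
      ultimately show ?thesis by blast
    qed
  qed
qed

text \<open>This makes the set behind the infimum in \<open>OPT\<close> nonempty, so that a lower
  bound on all policies becomes a lower bound on \<open>OPT\<close>.\<close>

lemma exists_valid_policy: "\<exists>P. valid_policy n M F P (\<lambda>i. mstart (M i)) {}"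
proof -
  define A where "A = (\<Union>i\<in>{1..n}. mean_val (M i) ` mterm (M i) \<union>
    (\<Union>s\<in>nonterm (M i). mcost (M i) ` macts (M i) s))"
  have "finite (mterm (M i))" "finite (nonterm (M i))" if "i \<in> {1..n}" for i
    using finite_mdp.term_states[OF mdps[OF that]] finite_mdp.finite_states[OF mdps[OF that]]
      finite_subset by auto
  then have "finite A"
    unfolding A_def
    by (intro finite_UN_I finite_UnI finite_imageI finite_mdp.finite_acts[OF mdps]) auto
  then have "bdd_above A"
    by (rule bdd_above_finite)
  then obtain C where C: "\<And>x. x \<in> A \<Longrightarrow> x \<le> C"
    unfolding bdd_above_def by blast
  \<comment> \<open>Every move costs at most \<open>K\<close> and lowers \<open>remaining\<close> by
    at least one, so \<open>K\<close> times \<open>remaining\<close> is a decreasing potential. The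
    maximum with \<open>0\<close> keeps it nonnegative.\<close>
  define K where "K = max 0 C"
  have step: "c + K * real k \<le> K * real l" if "c \<le> C" "k < l" for c k l
  proof -
    have "K * (1 + real k) \<le> K * real l"
      using that by (intro mult_left_mono) (auto simp: K_def)
    then show ?thesis
      using that(1) unfolding K_def by (simp add: algebra_simps)
  qed
  have "\<exists>P. valid_policy n M F P (\<lambda>i. mstart (M i)) {} \<and>
      policy_cost M P (\<lambda>i. mstart (M i)) \<le> K * real (remaining (\<lambda>i. mstart (M i)) {})"
  proof (rule policy_of_decreasing_potential)
    fix q X assume q: "proper_states q" "X \<subseteq> {1..n}" "X \<notin> F"
    then have "X \<noteq> {1..n}"
      using ground_in_F by blast
    then obtain i where i: "i \<in> {1..n} - X" and i': "i \<in> {1..n}"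
      using q(2) by blast
    let ?goal = "\<lambda>i. q i \<in> mterm (M i) \<and>
        mean_val (M i) (q i) + K * real (remaining q (insert i X)) \<le> K * real (remaining q X) \<or>
      q i \<in> nonterm (M i) \<and> (\<exists>a\<in>macts (M i) (q i). mcost (M i) a +
        measure_pmf.expectation (mtrans (M i) (q i) a) (\<lambda>s. K * real (remaining (q(i := s)) X))
          \<le> K * real (remaining q X))"
    have "?goal i"
    proof (cases "q i \<in> mterm (M i)")
      case True
      then have "mean_val (M i) (q i) \<in> A"
        using i' unfolding A_def by blast
      from step[OF C[OF this] remaining_accept[OF i]] True show ?thesis by blast
    next
      case False
      then have s: "q i \<in> nonterm (M i)"
        using q(1) i' by blast
      obtain a where a: "a \<in> macts (M i) (q i)"
        using finite_mdp.acts_nonempty[OF mdps[OF i'] s] by blast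
      have "mcost (M i) a \<in> A"
        using i' s a unfolding A_def by blast
      note le = step[OF C[OF this] remaining_advance[of i q a _ X, OF i' s a]]
      have "measure_pmf.expectation (mtrans (M i) (q i) a) (\<lambda>s. K * real (remaining (q(i := s)) X)) \<le>
          measure_pmf.expectation (mtrans (M i) (q i) a) (\<lambda>s. K * real (remaining q X) - mcost (M i) a)"
        by (rule expectation_mono[OF finite_trans[OF i' s a]])
          (use le in \<open>simp add: le_diff_eq add.commute\<close>)
      then have "mcost (M i) a + measure_pmf.expectation (mtrans (M i) (q i) a)
          (\<lambda>s. K * real (remaining (q(i := s)) X)) \<le> K * real (remaining q X)"
        by simp
      with s a show ?thesis by blast
    qed
    with i show "\<exists>i\<in>{1..n} - X. ?goal i" by blast
  next
    fix q X
    show "0 \<le> K * real (remaining q X)"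
      by (simp add: K_def)
  qed (fact proper_start, simp)
  then show ?thesis by blast
qed

text \<open>Move the fresh \<open>i\<close> whose index \<open>g\<close> is least. The weights of
  the other fresh elements are at least their own indices, hence at least \<open>g\<close>, so every
  threshold for \<open>i\<close> is at least \<open>g\<close>. There \<open>accept\<close> and
  \<open>advance\<close> apply, and the potential falls in expectation by at least the cost of the
  move.\<close>

lemma index_policy:
  assumes Y: "finite Y" "Y \<subseteq> {0..}"
    and V: "\<And>i s. i \<in> {1..n} \<Longrightarrow> set_pmf (V i s) \<subseteq> Y"
    and k: "\<And>i s. i \<in> {1..n} \<Longrightarrow> s \<in> mstates (M i) \<Longrightarrow> k i s \<in> Y \<and> set_pmf (V i s) \<subseteq> {k i s..}"
    and accept: "\<And>i s t. i \<in> {1..n} \<Longrightarrow> s \<in> mterm (M i) \<Longrightarrow> k i s \<le> t \<Longrightarrow>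
      mean_val (M i) s \<le> capped_mean (V i s) t"
    and act: "\<And>i s. i \<in> {1..n} \<Longrightarrow> s \<in> nonterm (M i) \<Longrightarrow> act i s \<in> macts (M i) s"
    and advance: "\<And>i s t. i \<in> {1..n} \<Longrightarrow> s \<in> nonterm (M i) \<Longrightarrow> k i s \<le> t \<Longrightarrow>
      mcost (M i) (act i s) + measure_pmf.expectation (mtrans (M i) s (act i s))
        (\<lambda>s'. capped_mean (V i s') t) \<le> capped_mean (V i s) t"
    and "proper_states q" "X \<subseteq> {1..n}"
  shows "\<exists>P. valid_policy n M F P q X \<and> policy_cost M P q \<le> expected_completion (\<lambda>i. V i (q i)) X"
proof (rule policy_of_decreasing_potential[OF _ _ assms(8,9)])
  fix q X assume "X \<in> F"
  moreover have "set_pmf (V i (q i)) \<subseteq> {0..}" if "i \<in> {1..n}" for i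
    using V[OF that] Y(2) by blast
  ultimately have "expected_completion (\<lambda>i. V i (q i)) X = 0"
    by (rule expected_completion_in_F)
  then show "0 \<le> expected_completion (\<lambda>i. V i (q i)) X" by simp
next
  fix q X assume q: "proper_states q" and X: "X \<subseteq> {1..n}" "X \<notin> F"
  have "finite {j. fresh X j}"
    by (rule finite_subset[OF _ finite_ground]) (use fresh_ground in blast)
  moreover have "{j. fresh X j} \<noteq> {}"
    using exists_fresh[OF X] by blast
  ultimately obtain i where fresh: "fresh X i" and min: "\<And>j. fresh X j \<Longrightarrow> k i (q i) \<le> k j (q j)"
    using ex_is_arg_min_if_finite[of "{j. fresh X j}" "\<lambda>j. k j (q j)"]
    unfolding is_arg_min_linorder by auto
  have i: "i \<in> {1..n} - X" and i': "i \<in> {1..n}"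
    using fresh_ground[OF fresh] fresh unfolding fresh_def by auto
  define g where "g = k i (q i)"
  define W where "W = (\<lambda>j. V j (q j))"
  have W: "\<And>j. j \<in> {1..n} \<Longrightarrow> set_pmf (W j) \<subseteq> Y"
    using V unfolding W_def by blast
  obtain T where T: "finite (set_pmf T)" "set_pmf T \<subseteq> {0..}"
    and T_g: "\<forall>g\<in>Y. fresh X i \<longrightarrow> (\<forall>j. fresh X j \<longrightarrow> j \<noteq> i \<longrightarrow> set_pmf (W j) \<subseteq> {g..}) \<longrightarrow> set_pmf T \<subseteq> {g..}"
    and eq: "\<forall>U. set_pmf U \<subseteq> Y \<longrightarrow> expected_completion (W(i := U)) X =
      expected_completion W (insert i X) + measure_pmf.expectation T (capped_mean U)"
    using expected_completion_threshold[OF X(1) i Y W] .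
  have "g \<in> Y"
    using k[OF i'] q i' unfolding g_def by blast
  moreover have "set_pmf (W j) \<subseteq> {g..}" if "fresh X j" for j
  proof -
    have "set_pmf (V j (q j)) \<subseteq> {k j (q j)..}"
      using k[of j "q j"] q fresh_ground[OF that] by blast
    then show ?thesis
      using min[OF that] unfolding W_def g_def by force
  qed
  ultimately have T_ge: "\<And>t. t \<in> set_pmf T \<Longrightarrow> k i (q i) \<le> t"
    using T_g fresh unfolding g_def by blast
  have W_X: "expected_completion W X =
      expected_completion W (insert i X) + measure_pmf.expectation T (capped_mean (W i))"
    using eq[rule_format, OF W[OF i']] by simp
  have W_upd: "(\<lambda>j. V j ((q(i := s)) j)) = W(i := V i s)" for s
    unfolding W_def by auto
  let ?goal = "\<lambda>i. q i \<in> mterm (M i) \<and> mean_val (M i) (q i) +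
      expected_completion (\<lambda>j. V j (q j)) (insert i X) \<le> expected_completion (\<lambda>j. V j (q j)) X \<or>
    q i \<in> nonterm (M i) \<and> (\<exists>a\<in>macts (M i) (q i). mcost (M i) a +
      measure_pmf.expectation (mtrans (M i) (q i) a)
        (\<lambda>s. expected_completion (\<lambda>j. V j ((q(i := s)) j)) X)
      \<le> expected_completion (\<lambda>j. V j (q j)) X)"
  have "?goal i"
  proof (cases "q i \<in> mterm (M i)")
    case True
    have "measure_pmf.expectation T (\<lambda>_. mean_val (M i) (q i)) \<le>
        measure_pmf.expectation T (capped_mean (W i))"
      by (rule expectation_mono[OF T(1)]) (use accept[OF i' True] T_ge in \<open>auto simp: W_def\<close>)
    then show ?thesis
      using True W_X unfolding W_def by simp
  next
    case False
    then have s: "q i \<in> nonterm (M i)"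
      using q i' by auto
    note a = act[OF i' s]
    note fin = finite_trans[OF i' s a]
    let ?p = "mtrans (M i) (q i) (act i (q i))"
    have "mcost (M i) (act i (q i)) + measure_pmf.expectation ?p (\<lambda>s. expected_completion (W(i := V i s)) X) =
        mcost (M i) (act i (q i)) + measure_pmf.expectation ?p
          (\<lambda>s. expected_completion W (insert i X) + measure_pmf.expectation T (capped_mean (V i s)))"
      using eq V[OF i'] by simp
    also have "\<dots> = expected_completion W (insert i X) + measure_pmf.expectation T
        (\<lambda>t. mcost (M i) (act i (q i)) + measure_pmf.expectation ?p (\<lambda>s. capped_mean (V i s) t))"
      using expectation_swap[OF T(1) fin, of "\<lambda>t s'. capped_mean (V i s') t"]
      by (simp add: expectation_add[OF T(1)] expectation_add[OF fin])
    also have "\<dots> \<le> expected_completion W (insert i X) + measure_pmf.expectation T (capped_mean (W i))"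
      by (intro add_left_mono expectation_mono[OF T(1)])
        (use advance[OF i' s] T_ge in \<open>auto simp: W_def\<close>)
    also have "\<dots> = expected_completion W X"
      using W_X by simp
    finally show ?thesis
      using s a unfolding W_upd unfolding W_def by blast
  qed
  with i show "\<exists>i\<in>{1..n} - X. ?goal i" by blast
qed

end

section \<open>The commitment gap\<close>

text \<open>If \<open>W\<close> has truncated means \<open>curve M s\<close>, then
  \<open>r W\<close> has truncated mean \<open>r * curve M s (y / r)\<close> at \<open>y\<close>.
  The rescaling preserves everything that \<open>surrogate_exists\<close> asks of a curve.\<close>

lemma (in finite_mdp) scaled_curve_surrogate:
  assumes Y: "finite Y" "0 \<in> Y" "\<And>y. y \<in> Y \<Longrightarrow> 0 \<le> y" and r: "0 < r"
  shows "\<exists>W. set_pmf W \<subseteq> Y \<and> (\<forall>y\<in>Y. capped_mean W y = r * curve M s (y / r))"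
proof (rule surrogate_exists[OF Y])
  show "r * curve M s (0 / r) = 0"
    by (simp add: curve_0)
  show "r * curve M s (y / r) \<le> y" if "0 \<le> y" for y
    using curve_le_outside[of "y / r" s] that r by (simp add: le_divide_eq mult.commute)
  show "r * curve M s (x / r) \<le> r * curve M s (y / r)" if "0 \<le> x" "x \<le> y" for x y
    using that r by (intro mult_left_mono curve_mono divide_right_mono) auto
  show "c * (r * curve M s (x / r)) + (1 - c) * (r * curve M s (y / r)) \<le>
      r * curve M s ((c * x + (1 - c) * y) / r)"
    if "0 \<le> c" "c \<le> 1" "0 \<le> x" "0 \<le> y" for c x y
  proof -
    have "c * curve M s (x / r) + (1 - c) * curve M s (y / r) \<le>
        curve M s (c * (x / r) + (1 - c) * (y / r))"
      using that r by (intro curve_concave) auto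
    then have "r * (c * curve M s (x / r) + (1 - c) * curve M s (y / r)) \<le>
        r * curve M s (c * (x / r) + (1 - c) * (y / r))"
      using r by (intro mult_left_mono) auto
    then show ?thesis
      by (simp add: algebra_simps add_divide_distrib diff_divide_distrib)
  qed
qed

text \<open>The chain of bounds is: the committed optimum, the index policy, the expected completion
  for the surrogates \<open>U\<close> of the chains, that for the scaled surrogates \<open>V\<close>
  of the MDPs, and finally \<open>\<alpha>\<close> times the cost of an arbitrary policy.\<close>

lemma OPT_committed_le:
  fixes M :: "nat \<Rightarrow> ('s, 'a) ci_mdp"
  assumes \<alpha>: "1 \<le> \<alpha>" and inst: "matroid_min_cics n M F"
    and approx: "\<And>i. i \<in> {1..n} \<Longrightarrow> local_approximation \<alpha> (M i) (\<pi> i)"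
  shows "OPT n (\<lambda>i. committed (M i) (\<pi> i)) F \<le> \<alpha> * OPT n M F"
    "0 \<le> OPT n M F" "0 \<le> OPT n (\<lambda>i. committed (M i) (\<pi> i)) F"
proof -
  define N where "N = (\<lambda>i. committed (M i) (\<pi> i))"
  obtain indep where "matroid {1..n} indep" "F = containing_basis {1..n} indep"
    using inst unfolding matroid_min_cics_def by blast
  then interpret matroid_family "{1..n}" indep F
    by unfold_locales
  have M: "finite_mdp (M i)" if "i \<in> {1..n}" for i
    using inst that finite_mdp_if_costly_info_mdp unfolding matroid_min_cics_def by blast
  have N: "finite_mdp (N i)" if "i \<in> {1..n}" for i
    using finite_mdp_committed[OF M[OF that]] approx[OF that] unfolding N_def local_approximation_def
    by blast
  interpret M: cics n indep F M
    by (intro cics.intro cics_axioms.intro matroid_family_axioms M)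
  interpret N: cics n indep F N
    by (intro cics.intro cics_axioms.intro matroid_family_axioms N)
  have N_sel: "macts (N i) s = {s}" "mstates (N i) = mstates (M i)" "mstart (N i) = mstart (M i)" for i s
    unfolding N_def committed_def by simp_all

  define is_index where "is_index i s k \<longleftrightarrow> 0 \<le> k \<and> curve (N i) s k = k \<and>
      (s \<in> mterm (N i) \<longrightarrow> (\<forall>y\<ge>k. mean_val (N i) s \<le> curve (N i) s y)) \<and>
      (s \<in> nonterm (N i) \<longrightarrow> (\<forall>y\<ge>k. mcost (N i) s +
        measure_pmf.expectation (mtrans (N i) s s) (\<lambda>s'. curve (N i) s' y) \<le> curve (N i) s y))"
    for i s k
  have "\<exists>k. is_index i s k" if "i \<in> {1..n}" "s \<in> mstates (N i)" for i s
    unfolding is_index_def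
    by (rule finite_mdp.chain_index[OF N[OF that(1)] that(2), of "\<lambda>s. s"])
      (simp add: N_sel, blast)
  then obtain k where "\<And>i s. i \<in> {1..n} \<Longrightarrow> s \<in> mstates (N i) \<Longrightarrow> is_index i s (k i s)"
    by metis
  then have k_nonneg: "\<And>i s. i \<in> {1..n} \<Longrightarrow> s \<in> mstates (N i) \<Longrightarrow> 0 \<le> k i s"
    and k_fixed: "\<And>i s. i \<in> {1..n} \<Longrightarrow> s \<in> mstates (N i) \<Longrightarrow> curve (N i) s (k i s) = k i s"
    and k_accept: "\<And>i s y. i \<in> {1..n} \<Longrightarrow> s \<in> mstates (N i) \<Longrightarrow> s \<in> mterm (N i) \<Longrightarrow> k i s \<le> y \<Longrightarrow>
      mean_val (N i) s \<le> curve (N i) s y"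
    and k_advance: "\<And>i s y. i \<in> {1..n} \<Longrightarrow> s \<in> mstates (N i) \<Longrightarrow> s \<in> nonterm (N i) \<Longrightarrow> k i s \<le> y \<Longrightarrow>
      mcost (N i) s + measure_pmf.expectation (mtrans (N i) s s) (\<lambda>s'. curve (N i) s' y)
        \<le> curve (N i) s y"
    unfolding is_index_def by simp_all

  \<comment> \<open>The inequalities for the chains hold only above the index of the state, so each
    index must be a grid point for the interpolation to stay above it. For the original MDPs they
    hold at all nonnegative points, and \<open>0\<close> plays that part.\<close>
  define Y where "Y = insert 0 (\<Union>i\<in>{1..n}. k i ` mstates (N i))"
  have "finite Y"
    unfolding Y_def using finite_mdp.finite_states[OF N] by simp
  moreover have Y_nonneg: "0 \<le> y" if "y \<in> Y" for y
    using that k_nonneg unfolding Y_def by blast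
  ultimately have Y: "finite Y" "0 \<in> Y" "\<And>y. y \<in> Y \<Longrightarrow> 0 \<le> y" "Y \<subseteq> {0..}"
    unfolding Y_def by auto
  have kY: "k i s \<in> Y" if "i \<in> {1..n}" "s \<in> mstates (N i)" for i s
    using that unfolding Y_def by blast
  \<comment> \<open>\<open>V\<close> stands for \<open>\<alpha>\<close> times the surrogate weight
    of an MDP state, and \<open>U\<close> below for the unscaled surrogate weight of a chain
    state.\<close>
  have "\<exists>W. set_pmf W \<subseteq> Y \<and> (\<forall>y\<in>Y. capped_mean W y = \<alpha> * curve (M i) s (y / \<alpha>))"
    if "i \<in> {1..n}" for i s
    using finite_mdp.scaled_curve_surrogate[OF M[OF that] Y(1-3), of \<alpha> s] \<alpha> by simp
  then obtain V where V: "\<And>i s. i \<in> {1..n} \<Longrightarrow> set_pmf (V i s) \<subseteq> Y"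
    and V_eq: "\<And>i s y. i \<in> {1..n} \<Longrightarrow> y \<in> Y \<Longrightarrow> capped_mean (V i s) y = \<alpha> * curve (M i) s (y / \<alpha>)"
    by metis
  have "\<exists>W. set_pmf W \<subseteq> Y \<and> (\<forall>y\<in>Y. capped_mean W y = curve (N i) s y)"
    if "i \<in> {1..n}" for i s
    using finite_mdp.scaled_curve_surrogate[OF N[OF that] Y(1-3), of 1 s] by simp
  then obtain U where U: "\<And>i s. i \<in> {1..n} \<Longrightarrow> set_pmf (U i s) \<subseteq> Y"
    and U_eq: "\<And>i s y. i \<in> {1..n} \<Longrightarrow> y \<in> Y \<Longrightarrow> capped_mean (U i s) y = curve (N i) s y"
    by metis

  define G where "G = expected_completion (\<lambda>i. V i (mstart (M i))) {}"
  have lower: "G \<le> \<alpha> * policy_cost M P (\<lambda>i. mstart (M i))"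
    if P: "valid_policy n M F P (\<lambda>i. mstart (M i)) {}" for P
    unfolding G_def
  proof (rule M.policy_lower_bound[OF Y(1,4) V _ _ P empty_subsetI M.proper_start])
    fix i s t assume i: "i \<in> {1..n}" and s: "s \<in> mterm (M i)" and t: "0 \<le> (t :: real)"
    have "1 * capped_mean (V i s) t \<le> 1 * (\<alpha> * mean_val (M i) s)"
    proof (rule capped_mean_le_on_grid[OF Y(1-3) V[OF i] Y(2) t])
      fix y assume y: "y \<in> Y" "0 \<le> y"
      have "curve (M i) s (y / \<alpha>) \<le> mean_val (M i) s"
        using finite_mdp.curve_terminal[OF M[OF i] s, of "y / \<alpha>"] y \<alpha> by simp
      then show "1 * capped_mean (V i s) y \<le> 1 * (\<alpha> * mean_val (M i) s)"
        using V_eq[OF i y(1)] \<alpha> by simp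
    qed
    then show "capped_mean (V i s) t \<le> \<alpha> * mean_val (M i) s" by simp
  next
    fix i s a t
    assume i: "i \<in> {1..n}" and s: "s \<in> nonterm (M i)" "a \<in> macts (M i) s" and t: "0 \<le> (t :: real)"
    have "1 * capped_mean (V i s) t \<le> 1 * (\<alpha> * mcost (M i) a) +
        1 * measure_pmf.expectation (mtrans (M i) s a) (\<lambda>s'. capped_mean (V i s') t)"
    proof (rule capped_mean_mixture[OF Y(1,2) t V[OF i] M.finite_trans[OF i s] V[OF i]])
      fix y assume y: "y \<in> Y" "0 \<le> y"
      have "\<alpha> * curve (M i) s (y / \<alpha>) \<le> \<alpha> * (mcost (M i) a +
          measure_pmf.expectation (mtrans (M i) s a) (\<lambda>s'. curve (M i) s' (y / \<alpha>)))"
        using finite_mdp.curve_advance_le[OF M[OF i] s, of "y / \<alpha>"] y \<alpha>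
        by (intro mult_left_mono) auto
      then show "1 * capped_mean (V i s) y \<le> 1 * (\<alpha> * mcost (M i) a) +
        1 * measure_pmf.expectation (mtrans (M i) s a) (\<lambda>s'. capped_mean (V i s') y)"
        by (simp add: V_eq[OF i y(1)] distrib_left)
    qed
    then show "capped_mean (V i s) t \<le> \<alpha> * mcost (M i) a +
        measure_pmf.expectation (mtrans (M i) s a) (\<lambda>s'. capped_mean (V i s') t)" by simp
  qed

  have compare: "expected_completion (\<lambda>i. U i (mstart (N i))) {} \<le> G"
    unfolding G_def
  proof (rule expected_completion_mono[OF Y(1,4) U V])
    fix i t assume i: "i \<in> {1..n}" and t: "0 \<le> (t :: real)"
    have "1 * capped_mean (U i (mstart (N i))) t \<le> 1 * 0 +
        1 * measure_pmf.expectation (return_pmf ()) (\<lambda>_. capped_mean (V i (mstart (M i))) t)"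
    proof (rule capped_mean_mixture[OF Y(1,2) t U[OF i] _ V[OF i]])
      fix y assume y: "y \<in> Y" "0 \<le> y"
      \<comment> \<open>The local approximation with outside cost \<open>y / \<alpha>\<close> is
        exactly the comparison of the truncated means of \<open>U\<close> and \<open>V\<close> at
        \<open>y\<close>.\<close>
      have "optimality_curve (N i) (\<alpha> * (y / \<alpha>)) \<le> \<alpha> * optimality_curve (M i) (y / \<alpha>)"
        using approx[OF i] unfolding local_approximation_def N_def by blast
      then show "1 * capped_mean (U i (mstart (N i))) y \<le> 1 * 0 +
        1 * measure_pmf.expectation (return_pmf ()) (\<lambda>_. capped_mean (V i (mstart (M i))) y)"
        using \<alpha> by (simp add: U_eq[OF i y(1)] V_eq[OF i y(1)] curve_start)
    qed simp
    then show "capped_mean (U i (mstart (N i))) t \<le> capped_mean (V i (mstart (M i))) t" by simp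
  qed

  have "\<exists>P. valid_policy n N F P (\<lambda>i. mstart (N i)) {} \<and>
      policy_cost N P (\<lambda>i. mstart (N i)) \<le> expected_completion (\<lambda>i. U i (mstart (N i))) {}"
  proof (rule N.index_policy[OF Y(1,4) U, where k = k and act = "\<lambda>i s. s"])
    fix i s assume i: "i \<in> {1..n}" and s: "s \<in> mstates (N i)"
    have "finite (set_pmf (U i s))"
      using U[OF i] Y(1) finite_subset by blast
    then show "k i s \<in> Y \<and> set_pmf (U i s) \<subseteq> {k i s..}"
      using kY[OF i s] k_fixed[OF i s] U_eq[OF i kY[OF i s]]
      by (intro conjI set_pmf_ge_if_capped_mean) auto
  next
    fix i s t assume i: "i \<in> {1..n}" and s_term: "s \<in> mterm (N i)" and t: "k i s \<le> t"
    have s: "s \<in> mstates (N i)"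
      using finite_mdp.term_states[OF N[OF i]] s_term by blast
    \<comment> \<open>Here and for advancing, the factor \<open>-1\<close> turns the upper bounds of
      the interpolation lemmas into lower bounds, valid from the index \<open>k i s\<close>
      on.\<close>
    have "-1 * capped_mean (U i s) t \<le> -1 * mean_val (N i) s"
    proof (rule capped_mean_le_on_grid[OF Y(1-3) U[OF i] kY[OF i s] t])
      fix y assume "y \<in> Y" "k i s \<le> y"
      then show "-1 * capped_mean (U i s) y \<le> -1 * mean_val (N i) s"
        using k_accept[OF i s s_term] U_eq[OF i] by simp
    qed
    then show "mean_val (N i) s \<le> capped_mean (U i s) t" by simp
  next
    fix i s assume "i \<in> {1..n}" "s \<in> nonterm (N i)"
    then show "s \<in> macts (N i) s"
      by (simp add: N_sel)
  next
    fix i s t assume i: "i \<in> {1..n}" and s: "s \<in> nonterm (N i)" and t: "k i s \<le> t"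
    have s': "s \<in> mstates (N i)" and a: "s \<in> macts (N i) s"
      using s by (auto simp: N_sel)
    have "-1 * capped_mean (U i s) t \<le> -1 * mcost (N i) s +
        -1 * measure_pmf.expectation (mtrans (N i) s s) (\<lambda>s'. capped_mean (U i s') t)"
    proof (rule capped_mean_mixture[OF Y(1) kY[OF i s'] t U[OF i] N.finite_trans[OF i s a] U[OF i]])
      fix y assume y: "y \<in> Y" "k i s \<le> y"
      show "-1 * capped_mean (U i s) y \<le> -1 * mcost (N i) s +
        -1 * measure_pmf.expectation (mtrans (N i) s s) (\<lambda>s'. capped_mean (U i s') y)"
        using k_advance[OF i s' s y(2)] by (simp add: U_eq[OF i y(1)])
    qed
    then show "mcost (N i) s + measure_pmf.expectation (mtrans (N i) s s)
        (\<lambda>s'. capped_mean (U i s') t) \<le> capped_mean (U i s) t" by simp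
  qed (assumption, fact N.proper_start, simp)
  then have upper: "OPT n N F \<le> G"
    using N.OPT_le compare by (meson order_trans)

  have M_ge: "c \<le> OPT n M F" if "\<And>P. valid_policy n M F P (\<lambda>i. mstart (M i)) {} \<Longrightarrow>
      c \<le> policy_cost M P (\<lambda>i. mstart (M i))" for c
    unfolding OPT_def by (rule cINF_greatest) (use that M.exists_valid_policy in auto)
  have "OPT n N F / \<alpha> \<le> OPT n M F"
  proof (rule M_ge)
    fix P assume "valid_policy n M F P (\<lambda>i. mstart (M i)) {}"
    from lower[OF this] show "OPT n N F / \<alpha> \<le> policy_cost M P (\<lambda>i. mstart (M i))"
      using upper \<alpha> by (simp add: divide_le_eq mult.commute)
  qed
  then show "OPT n (\<lambda>i. committed (M i) (\<pi> i)) F \<le> \<alpha> * OPT n M F"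
    using \<alpha> by (simp add: N_def divide_le_eq mult.commute)
  show "0 \<le> OPT n M F"
    by (rule M_ge) (rule M.policy_cost_nonneg)
  have "0 \<le> OPT n N F"
    unfolding OPT_def
    by (rule cINF_greatest) (use N.exists_valid_policy N.policy_cost_nonneg in auto)
  then show "0 \<le> OPT n (\<lambda>i. committed (M i) (\<pi> i)) F"
    unfolding N_def .
qed

theorem theorem3:
  fixes n :: nat and M :: "nat \<Rightarrow> ('s, 'a) ci_mdp" and F :: "nat set set" and \<alpha> :: real
  assumes "1 \<le> \<alpha>"
    and "matroid_min_cics n M F"
    and "\<forall>i\<in>{1..n}. \<exists>\<pi>. local_approximation \<alpha> (M i) \<pi>"
  shows "commitment_gap n M F \<le> ereal \<alpha>"
proof -
  obtain \<P> where \<P>: "\<And>i. i \<in> {1..n} \<Longrightarrow> local_approximation \<alpha> (M i) (\<P> i)"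
    using assms(3) by metis
  let ?N = "\<lambda>i. committed (M i) (\<P> i)"
  note opt = OPT_committed_le[OF assms(1,2) \<P>]
  have "commitment_gap n M F \<le> ereal (OPT n ?N F) / ereal (OPT n M F)"
    unfolding commitment_gap_def
    by (rule INF_lower) (use \<P> in \<open>auto simp: local_approximation_def\<close>)
  also have "\<dots> \<le> ereal \<alpha>"
  proof (cases "OPT n M F = 0")
    \<comment> \<open>A zero optimum forces the committed optimum to be zero too, and then the
      quotient is \<open>0 / 0 = 0\<close>.\<close>
    case True
    then have "OPT n ?N F = 0"
      using opt by simp
    with True assms(1) show ?thesis
      by (simp add: divide_ereal_def)
  next
    case False
    then show ?thesis
      using opt by (simp add: divide_le_eq)
  qed
  finally show ?thesis .
qed

end
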